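(* Let $\Psi^N=\{\varphi^N_{0,k},\ \psi^N_{j,k}\}_{j\in\mathbb{Z}_+,\,k\in\mathbb{Z}}$ be a nonstationary Parseval wavelet frame for $L_2(\mathbb{R})$ generated by the nonstationary unitary extension principle (as described in the context), and suppose $\varphi^N_0\in L_1(\mathbb{R})$ and $\psi^N_j\in L_1(\mathbb{R})$ for all $j\in\mathbb{Z}_+$. Define the periodizations $$\varphi^P_0(x):=\sum_{n\in\mathbb{Z}}\varphi^N_0(x-n),\qquad \psi^P_j(x):=\sum_{n\in\mathbb{Z}}\psi^N_j(x-n),\quad j\in\mathbb{Z}_+.$$ Then $\Psi^P=\{\varphi^P_0,\ \psi^P_{j,k}\}_{j\in\mathbb{Z}_+,\,k=0,\dots,2^j-1}$ is a Parseval wavelet frame for $L_2(\mathbb{T})$.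
   Context: $\mathbb{Z}_+=\{0,1,2,\dots\}$. $L_2(\mathbb{T})$ is the space of $1$-periodic square-integrable complex-valued functions with inner product $(f,g)=\int_0^1 f\overline g$. For $f\in L_2(\mathbb{R})$, $\widehat f(\xi)=\int_{\mathbb{R}}f(x)e^{-2\pi i\xi x}\,dx$. For a function $f_j$ in $L_2(\mathbb{T})$ or $L_2(\mathbb{R})$, $f_{j,k}(x):=f_j(x-2^{-j}k)$. A sequence $(f_n)$ in a Hilbert space $H$ is a Parseval frame if $\sum_n|(f,f_n)|^2=\|f\|^2$ for all $f\in H$. Nonstationary Parseval wavelet frame generated by the unitary extension principle: there are functions $\varphi^N_j\in L_2(\mathbb{R})$, $j\in\mathbb{Z}_+$, and $1$-periodic functions $m^N_{0,j}\in L_2(\mathbb{T})$, $j\ge1$, such that (the identities being understood pointwise, for every $\xi\in\mathbb{R}$) $$\lim_{j\to\infty}2^{j/2}\widehat{\varphi^N_j}(\xi)=1,\qquad |m^N_{0,j}(\xi)|^2+|m^N_{0,j}(\xi+1/2)|^2=2,\qquad \widehat{\varphi^N_j}(\xi)=m^N_{0,j+1}(2^{-j-1}\xi)\,\widehat{\varphi^N_{j+1}}(\xi),$$ and the functions $\psi^N_j\in L_2(\mathbb{R})$, $j\in\mathbb{Z}_+$, are given by $$\widehat{\psi^N_j}(\xi)=m^N_{1,j+1}(2^{-j-1}\xi)\,\widehat{\varphi^N_{j+1}}(\xi),\qquad m^N_{1,j}(\xi)=e^{2\pi i\xi}\,\overline{m^N_{0,j}(\xi+1/2)}.$$ (Under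 these conditions $\{\varphi^N_{0,k},\psi^N_{j,k}:j\in\mathbb{Z}_+,k\in\mathbb{Z}\}$ is a Parseval frame for $L_2(\mathbb{R})$.) For $\varphi^N_0,\psi^N_j\in L_1(\mathbb{R})$ the Fourier transforms $\widehat{\varphi^N_0},\widehat{\psi^N_j}$ denote the continuous functions given by the integral. *)

theory Defs
  imports "HOL-Analysis.Analysis"
begin

text \<open>
  Square-integrable functions are actual functions, not classes modulo null sets.
\<close>

definition L2_R :: "(real \<Rightarrow> complex) set" where
  "L2_R = {f \<in> borel_measurable lebesgue. integrable lebesgue (\<lambda>x. (cmod (f x))\<^sup>2)}"

definition L2_T :: "(real \<Rightarrow> complex) set" where
  "L2_T = {f \<in> borel_measurable lebesgue. (\<forall>x. f (x + 1) = f x) \<and>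
             integrable (lebesgue_on {0..1}) (\<lambda>x. (cmod (f x))\<^sup>2)}"

definition inner_T :: "(real \<Rightarrow> complex) \<Rightarrow> (real \<Rightarrow> complex) \<Rightarrow> complex" where
  "inner_T f g = (LINT x|lebesgue_on {0..1}. f x * cnj (g x))"

text \<open>
  Parseval frame in the space \<open>H\<close> with inner product \<open>ip\<close>. The norm of \<open>H\<close> is the one induced
  by \<open>ip\<close>, so the squared norm of \<open>f\<close> is the (real) number \<open>ip f f\<close>. The terms are
  nonnegative, hence unordered summation agrees with summation along any enumeration of \<open>I\<close>.
\<close>

definition parseval_frame ::
  "'f set \<Rightarrow> ('f \<Rightarrow> 'f \<Rightarrow> complex) \<Rightarrow> 'i set \<Rightarrow> ('i \<Rightarrow> 'f) \<Rightarrow> bool" where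
  "parseval_frame H ip I e \<longleftrightarrow>
     (\<forall>i\<in>I. e i \<in> H) \<and>
     (\<forall>f\<in>H. ((\<lambda>i. (cmod (ip f (e i)))\<^sup>2) has_sum Re (ip f f)) I)"

definition fourier :: "(real \<Rightarrow> complex) \<Rightarrow> real \<Rightarrow> complex" where
  "fourier f \<xi> = (LINT x|lebesgue. f x * cis (- 2 * pi * \<xi> * x))"

text \<open>
  \<open>g\<close> is a pointwise representative of the Fourier--Plancherel transform of a square-integrable
  function \<open>f\<close>, which need not be integrable: the transforms of the truncations of \<open>f\<close> to
  \<open>[-R, R]\<close> converge to \<open>g\<close> in mean square. The transform determines \<open>g\<close> only almost everywhere.
\<close>

definition is_fourier_L2 :: "(real \<Rightarrow> complex) \<Rightarrow> (real \<Rightarrow> complex) \<Rightarrow> bool" where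
  "is_fourier_L2 f g \<longleftrightarrow> f \<in> L2_R \<and> g \<in> L2_R \<and>
     ((\<lambda>R::real. \<integral>\<^sup>+\<xi>. ennreal ((cmod (fourier (\<lambda>x. indicat_real {-R..R} x *\<^sub>R f x) \<xi> - g \<xi>))\<^sup>2)
        \<partial>lebesgue) \<longlongrightarrow> 0) at_top"

definition wavelet_mask :: "(real \<Rightarrow> complex) \<Rightarrow> real \<Rightarrow> complex" where
  "wavelet_mask m \<xi> = cis (2 * pi * \<xi>) * cnj (m (\<xi> + 1/2))"

text \<open>
  The setup of the nonstationary unitary extension principle. The identities on the Fourier side
  are required at every point, so the representatives \<open>\<phi>h j\<close>, \<open>\<psi>h j\<close> of the Fourier transforms of
  \<open>\<phi> j\<close>, \<open>\<psi> j\<close> are part of the data. The masks are \<open>m0 j\<close> for \<open>j \<ge> 1\<close>; the value \<open>m0 0\<close> is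
  irrelevant.
\<close>

definition nonstationary_uep ::
  "(nat \<Rightarrow> real \<Rightarrow> complex) \<Rightarrow> (nat \<Rightarrow> real \<Rightarrow> complex) \<Rightarrow> (nat \<Rightarrow> real \<Rightarrow> complex) \<Rightarrow>
   (nat \<Rightarrow> real \<Rightarrow> complex) \<Rightarrow> (nat \<Rightarrow> real \<Rightarrow> complex) \<Rightarrow> bool" where
  "nonstationary_uep \<phi> \<phi>h m0 \<psi> \<psi>h \<longleftrightarrow>
     (\<forall>j. \<phi> j \<in> L2_R \<and> is_fourier_L2 (\<phi> j) (\<phi>h j)) \<and>
     (\<forall>j\<ge>1. m0 j \<in> L2_T) \<and>
     (\<forall>\<xi>. (\<lambda>j. complex_of_real (2 powr (real j / 2)) * \<phi>h j \<xi>) \<longlonglongrightarrow> 1) \<and>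
     (\<forall>j\<ge>1. \<forall>\<xi>. (cmod (m0 j \<xi>))\<^sup>2 + (cmod (m0 j (\<xi> + 1/2)))\<^sup>2 = 2) \<and>
     (\<forall>j \<xi>. \<phi>h j \<xi> = m0 (j + 1) (\<xi> / 2 ^ (j + 1)) * \<phi>h (j + 1) \<xi>) \<and>
     (\<forall>j. \<psi> j \<in> L2_R \<and> is_fourier_L2 (\<psi> j) (\<psi>h j)) \<and>
     (\<forall>j \<xi>. \<psi>h j \<xi> = wavelet_mask (m0 (j + 1)) (\<xi> / 2 ^ (j + 1)) * \<phi>h (j + 1) \<xi>)"

text \<open>
  For integrable \<open>f\<close> the series converges absolutely for almost every \<open>x\<close>; on the exceptional
  null set, which is invariant under integer translations, the value is \<open>0\<close>.
\<close>

definition periodize :: "(real \<Rightarrow> complex) \<Rightarrow> real \<Rightarrow> complex" where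
  "periodize f x = (\<Sum>\<^sub>\<infinity>n::int. f (x - of_int n))"

definition dyadic_shift :: "nat \<Rightarrow> int \<Rightarrow> (real \<Rightarrow> complex) \<Rightarrow> real \<Rightarrow> complex" where
  "dyadic_shift j k f x = f (x - of_int k / 2 ^ j)"

datatype wavelet_index = Scaling | Wavelet nat int

fun wavelet_system ::
  "(real \<Rightarrow> complex) \<Rightarrow> (nat \<Rightarrow> real \<Rightarrow> complex) \<Rightarrow> wavelet_index \<Rightarrow> real \<Rightarrow> complex" where
  "wavelet_system \<phi>0 \<psi> Scaling = \<phi>0"
| "wavelet_system \<phi>0 \<psi> (Wavelet j k) = dyadic_shift j k (\<psi> j)"

definition periodic_indices :: "wavelet_index set" where
  "periodic_indices = insert Scaling {Wavelet j k | j k. 0 \<le> k \<and> k < 2 ^ j}"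

end

(*
  Everything happens on the Fourier coefficients. The l-th coefficient of the periodization of an
  integrable function is its Fourier transform at l, so with c = (coefficients of f) the
  frame coefficients of f are sums over l of c(l) * cnj(psih_j(l)) * cis(2 pi l k / 2^j). By the
  discrete Parseval identity the coefficients of level j have total energy 2^j times the sum over
  the residues r mod 2^j of |sum over l = r (mod 2^j) of c(l) * cnj(psih_j(l))|^2. Let S_j be the
  same expression with phih_j in place of psih_j. The matrix of masks is sqrt 2 times a unitary one, so
  S_j plus the energy of level j equals S_(j+1), and the partial sums of the frame energy
  telescope. The refinement equation and the limit condition give
  2^j * (sum over l = r (mod 2^j) of |phih_j(l)|^2) <= 1, whence S_j(c) <= |c|^2; for finitely
  supported c the limit of S_j(c) is |c|^2, and this extends to all square-summable c by the
  parallelogram law. The same bound makes the Fourier coefficients of the periodizations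
  square-summable, and an integrable function with such coefficients is square-integrable.
*)

theory Submission
  imports Defs
begin

section \<open>Square-summable sequences and dyadic residue classes\<close>

text \<open>Only the values of the transforms at integers enter, and the integers form a null set:
  these values are accessible solely through the identities that hold at every point. The energy
  argument is therefore carried out for abstract arrays indexed by a level and an integer, without
  any integral. For levels \<open>j \<ge> 1\<close> the values of \<open>\<phi>h j\<close> stay mere
  array entries, since \<open>\<phi> j\<close> is not assumed integrable; only
  \<open>\<phi> 0\<close> and the \<open>\<psi> j\<close> are periodized, and for these the
  representatives are tied to the integrals. The obstacle on the function side is that periodizing a
  function in L1 and L2 of the line gives, in general, only an integrable function. That the frame
  elements lie in L2 of the circle is thus itself a consequence of the bound on the arrays, and it
  has to be known before the Parseval identity may be applied to their inner products. The mask
  matrix is unitary up to sqrt 2 because its second row is the conjugate of the first with the two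
  entries exchanged and one sign changed; that sign is produced by the factor
  \<open>cis (2 * pi * \<xi>)\<close> of the wavelet mask, which is negated by a shift of
  1/2.\<close>

lemma bounded_finite_sums_imp_summable_on:
  fixes f :: "'a \<Rightarrow> real"
  assumes "\<And>x. x \<in> I \<Longrightarrow> 0 \<le> f x"
    and "\<And>F. finite F \<Longrightarrow> F \<subseteq> I \<Longrightarrow> sum f F \<le> C"
  shows "f summable_on I" and "infsum f I \<le> C"
proof -
  show s: "f summable_on I"
    by (rule nonneg_bdd_above_summable_on) (auto intro!: bdd_aboveI2 assms)
  show "infsum f I \<le> C"
    by (rule infsum_le_finite_sums[OF s]) (use assms in auto)
qed

lemma l2_product_summable_on:
  fixes a b :: "'a \<Rightarrow> complex"
  assumes a: "(\<lambda>l. (cmod (a l))\<^sup>2) summable_on I" and b: "(\<lambda>l. (cmod (b l))\<^sup>2) summable_on I"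
  shows "(\<lambda>l. cmod (a l * cnj (b l))) summable_on I"
  by (rule abs_summable_product[where x = a and y = "\<lambda>l. cnj (b l)"])
     (use a b in \<open>simp_all add: norm_mult power2_eq_square\<close>)

lemma l2_Cauchy_Schwarz_infsum:
  fixes a b :: "'a \<Rightarrow> complex"
  assumes a: "(\<lambda>l. (cmod (a l))\<^sup>2) summable_on I" and b: "(\<lambda>l. (cmod (b l))\<^sup>2) summable_on I"
  shows "(cmod (\<Sum>\<^sub>\<infinity>l\<in>I. a l * cnj (b l)))\<^sup>2
           \<le> (\<Sum>\<^sub>\<infinity>l\<in>I. (cmod (a l))\<^sup>2) * (\<Sum>\<^sub>\<infinity>l\<in>I. (cmod (b l))\<^sup>2)"
proof -
  let ?P = "(\<Sum>\<^sub>\<infinity>l\<in>I. (cmod (a l))\<^sup>2) * (\<Sum>\<^sub>\<infinity>l\<in>I. (cmod (b l))\<^sup>2)"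
  have "(\<Sum>l\<in>F. cmod (a l * cnj (b l))) \<le> sqrt ?P" if F: "finite F" "F \<subseteq> I" for F
  proof -
    have "(\<Sum>l\<in>F. cmod (a l * cnj (b l)))\<^sup>2 \<le> (\<Sum>l\<in>F. (cmod (a l))\<^sup>2) * (\<Sum>l\<in>F. (cmod (b l))\<^sup>2)"
      using Cauchy_Schwarz_ineq_sum[of "\<lambda>l. cmod (a l)" "\<lambda>l. cmod (b l)" F]
      by (simp add: norm_mult)
    also have "\<dots> \<le> ?P"
      by (intro mult_mono finite_sum_le_infsum a b F sum_nonneg infsum_nonneg) auto
    finally show ?thesis by (rule real_le_rsqrt)
  qed
  then have "(\<Sum>\<^sub>\<infinity>l\<in>I. cmod (a l * cnj (b l))) \<le> sqrt ?P"
    by (intro bounded_finite_sums_imp_summable_on(2)) auto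
  moreover have "cmod (\<Sum>\<^sub>\<infinity>l\<in>I. a l * cnj (b l)) \<le> (\<Sum>\<^sub>\<infinity>l\<in>I. cmod (a l * cnj (b l)))"
    by (rule norm_infsum_bound) (rule l2_product_summable_on[OF a b])
  ultimately have "cmod (\<Sum>\<^sub>\<infinity>l\<in>I. a l * cnj (b l)) \<le> sqrt ?P" by linarith
  then have "(cmod (\<Sum>\<^sub>\<infinity>l\<in>I. a l * cnj (b l)))\<^sup>2 \<le> (sqrt ?P)\<^sup>2"
    by (intro power_mono) auto
  moreover have "?P \<ge> 0" by (intro mult_nonneg_nonneg infsum_nonneg) auto
  ultimately show ?thesis by simp
qed

section \<open>Binary splitting of residue classes\<close>

definition residue_class :: "nat \<Rightarrow> int \<Rightarrow> int set" where
  "residue_class j r = {l. l mod 2 ^ j = r}"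

text \<open>The binary digit of weight \<open>2 ^ j\<close> decides between the two halves. The
  range of \<open>r\<close> matters: the class is given by its canonical remainder, so it is empty
  for \<open>r\<close> outside \<open>0..<2 ^ j\<close>.\<close>

lemma residue_class_Suc:
  assumes "0 \<le> r" "r < 2 ^ j"
  shows "residue_class j r = residue_class (Suc j) r \<union> residue_class (Suc j) (r + 2 ^ j)"
    and "residue_class (Suc j) r \<inter> residue_class (Suc j) (r + 2 ^ j) = {}"
proof -
  have *: "l mod 2 ^ j = r \<longleftrightarrow> l mod 2 ^ Suc j = r \<or> l mod 2 ^ Suc j = r + 2 ^ j" for l :: int
  proof -
    have "l mod 2 ^ Suc j = 2 ^ j * (l div 2 ^ j mod 2) + l mod 2 ^ j"
      using zmod_zmult2_eq[of 2 l "2 ^ j"] by (simp add: mult.commute)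
    then have "l mod 2 ^ Suc j = l mod 2 ^ j \<or> l mod 2 ^ Suc j = l mod 2 ^ j + 2 ^ j"
      using mod_2_eq_odd[of "l div 2 ^ j"] by auto
    moreover have "l mod 2 ^ Suc j mod 2 ^ j = l mod 2 ^ j"
      by (simp add: mod_mod_cancel)
    moreover have "0 \<le> l mod 2 ^ j" "l mod 2 ^ j < 2 ^ j" by simp_all
    moreover have "(r + 2 ^ j) mod 2 ^ j = r" "r mod 2 ^ j = r" using assms by auto
    ultimately show ?thesis by metis
  qed
  then show "residue_class j r = residue_class (Suc j) r \<union> residue_class (Suc j) (r + 2 ^ j)"
    by (auto simp: residue_class_def)
  show "residue_class (Suc j) r \<inter> residue_class (Suc j) (r + 2 ^ j) = {}"
    by (auto simp: residue_class_def)
qed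

lemma sum_dyadic_Suc:
  fixes f :: "int \<Rightarrow> 'a::comm_monoid_add"
  shows "(\<Sum>r\<in>{0..<2 ^ Suc j}. f r) = (\<Sum>r\<in>{0..<2 ^ j}. f r + f (r + 2 ^ j))"
proof -
  have "{0..<2 ^ Suc j} = {0..<2 ^ j} \<union> {2 ^ j..<2 ^ Suc j :: int}" by auto
  then have "(\<Sum>r\<in>{0..<2 ^ Suc j}. f r)
      = (\<Sum>r\<in>{0..<2 ^ j}. f r) + (\<Sum>r\<in>{2 ^ j..<2 ^ Suc j}. f r)"
    by (simp add: sum.union_disjoint ivl_disj_int)
  also have "(\<Sum>r\<in>{2 ^ j..<2 ^ Suc j}. f r) = (\<Sum>r\<in>{0..<2 ^ j}. f (r + 2 ^ j))"
    by (rule sum.reindex_bij_witness[of _ "\<lambda>r. r + 2 ^ j" "\<lambda>r. r - 2 ^ j"]) auto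
  finally show ?thesis by (simp add: sum.distrib)
qed

lemma infsum_residue_classes:
  fixes f :: "int \<Rightarrow> 'a::banach"
  assumes "f summable_on UNIV"
  shows "infsum f UNIV = (\<Sum>r\<in>{0..<2 ^ j}. infsum f (residue_class j r))"
proof -
  have U: "UNIV = (\<Union>r\<in>{0..<2 ^ j}. residue_class j r)"
    by (auto simp: residue_class_def)
  have "infsum f (\<Union>r\<in>{0..<2 ^ j}. residue_class j r)
     = (\<Sum>r\<in>{0..<2 ^ j}. infsum f (residue_class j r))"
    by (rule sum_infsum[symmetric])
       (auto simp: residue_class_def intro: summable_on_subset_banach[OF assms])
  then show ?thesis using U by simp
qed

section \<open>Discrete Fourier transform\<close>

lemma dft_orthogonality:
  fixes N :: int
  assumes N: "0 < N" and r: "0 \<le> r" "r < N" and s: "0 \<le> s" "s < N"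
  shows "(\<Sum>k\<in>{0..<N}. cis (2 * pi * of_int (r * k) / of_int N)
          * cnj (cis (2 * pi * of_int (s * k) / of_int N))) = (if r = s then of_int N else 0)"
proof -
  define z where "z = cis (2 * pi * of_int (r - s) / of_int N)"
  have power_z: "cis (2 * pi * of_int (r * int k) / of_int N)
      * cnj (cis (2 * pi * of_int (s * int k) / of_int N)) = z ^ k" for k
    unfolding z_def Complex.DeMoivre cis_cnj cis_mult
    by (rule arg_cong[where f = cis]) (simp add: algebra_simps diff_divide_distrib)
  have "(\<Sum>k\<in>{0..<N}. cis (2 * pi * of_int (r * k) / of_int N)
          * cnj (cis (2 * pi * of_int (s * k) / of_int N))) = (\<Sum>k<nat N. z ^ k)"
    by (rule sum.reindex_bij_witness[of _ int nat]) (use N in \<open>auto simp: power_z[symmetric]\<close>)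
  also have "\<dots> = (if r = s then of_int N else 0)"
  proof (cases "r = s")
    case True
    then show ?thesis using N by (simp add: z_def)
  next
    case False
    have "z \<noteq> 1"
    proof
      assume "z = 1"
      then have "cos (2 * pi * of_int (r - s) / of_int N) = 1"
        by (simp add: z_def complex_eq_iff)
      then obtain n :: int where "2 * pi * of_int (r - s) / of_int N = of_int n * 2 * pi"
        using cos_one_2pi_int by blast
      then have "(2 * pi) * of_int (r - s) = (2 * pi) * of_int (n * N)"
        using N by (simp add: field_simps)
      then have "of_int (r - s) = (of_int (n * N) :: real)"
        using mult_cancel_left[of "2 * pi"] by auto
      then have *: "r - s = n * N" by linarith
      have "\<bar>r - s\<bar> < N" using r s by linarith
      then have "\<bar>n\<bar> * N < 1 * N" using * N by (simp add: abs_mult)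
      then have "n = 0" using N by (simp add: mult_less_cancel_right)
      then show False using * False by simp
    qed
    moreover have "z ^ nat N = 1"
    proof -
      have "z ^ nat N = cis (2 * pi * of_int (r - s))"
        unfolding z_def Complex.DeMoivre using N by simp
      also have "\<dots> = 1" by (rule cis_multiple_2pi) simp
      finally show ?thesis .
    qed
    ultimately show ?thesis using False by (simp add: geometric_sum)
  qed
  finally show ?thesis .
qed

text \<open>Expanding the squares and summing over \<open>k\<close> innermost leaves only the
  diagonal terms, by orthogonality of the characters of Z/N.\<close>

lemma dft_Parseval:
  fixes d :: "int \<Rightarrow> complex" and N :: int
  assumes N: "0 < N"
  shows "(\<Sum>k\<in>{0..<N}. (cmod (\<Sum>r\<in>{0..<N}. d r * cis (2 * pi * of_int (r * k) / of_int N)))\<^sup>2)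
    = of_int N * (\<Sum>r\<in>{0..<N}. (cmod (d r))\<^sup>2)"
proof -
  let ?e = "\<lambda>r k. cis (2 * pi * of_int (r * k) / of_int N)"
  have "complex_of_real (\<Sum>k\<in>{0..<N}. (cmod (\<Sum>r\<in>{0..<N}. d r * ?e r k))\<^sup>2)
     = (\<Sum>k\<in>{0..<N}. (\<Sum>r\<in>{0..<N}. d r * ?e r k) * cnj (\<Sum>s\<in>{0..<N}. d s * ?e s k))"
    by (simp only: of_real_sum complex_norm_square)
  also have "\<dots> = (\<Sum>k\<in>{0..<N}. \<Sum>r\<in>{0..<N}. \<Sum>s\<in>{0..<N}.
        d r * cnj (d s) * (?e r k * cnj (?e s k)))"
    by (simp only: cnj_sum sum_product complex_cnj_mult) (simp add: ac_simps)
  also have "\<dots> = (\<Sum>r\<in>{0..<N}. \<Sum>k\<in>{0..<N}. \<Sum>s\<in>{0..<N}.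
        d r * cnj (d s) * (?e r k * cnj (?e s k)))"
    by (rule sum.swap)
  also have "\<dots> = (\<Sum>r\<in>{0..<N}. \<Sum>s\<in>{0..<N}. \<Sum>k\<in>{0..<N}.
        d r * cnj (d s) * (?e r k * cnj (?e s k)))"
    by (rule sum.cong[OF refl], rule sum.swap)
  also have "\<dots> = (\<Sum>r\<in>{0..<N}. \<Sum>s\<in>{0..<N}. d r * cnj (d s) * (if r = s then of_int N else 0))"
    by (intro sum.cong refl) (simp only: sum_distrib_left[symmetric], subst dft_orthogonality, auto simp: N)
  also have "\<dots> = (\<Sum>r\<in>{0..<N}. of_int N * complex_of_real ((cmod (d r))\<^sup>2))"
    by (intro sum.cong refl, subst complex_norm_square)
       (simp add: if_distrib[of "\<lambda>x. _ * x"] sum.delta' cong: if_cong)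
  also have "\<dots> = complex_of_real (of_int N * (\<Sum>r\<in>{0..<N}. (cmod (d r))\<^sup>2))"
    by (simp add: sum_distrib_left)
  finally show ?thesis using of_real_eq_iff by blast
qed

text \<open>The phase depends on \<open>l\<close> only modulo \<open>2 ^ j\<close>, so the series
  folds into a finite Fourier sum whose entries are the sums over residue classes. This converts
  energies over the translates \<open>k\<close> into energies over remainders
  \<open>r\<close>.\<close>

lemma dft_summable_Parseval:
  fixes d :: "int \<Rightarrow> complex"
  assumes d: "(\<lambda>l. cmod (d l)) summable_on UNIV"
  shows "(\<Sum>k\<in>{0..<2 ^ j}. (cmod (\<Sum>\<^sub>\<infinity>l. d l * cis (2 * pi * of_int (l * k) / 2 ^ j)))\<^sup>2)
    = 2 ^ j * (\<Sum>r\<in>{0..<2 ^ j}. (cmod (infsum d (residue_class j r)))\<^sup>2)"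
proof -
  have c: "cis (2 * pi * of_int (l * k) / 2 ^ j) = cis (2 * pi * of_int (r * k) / 2 ^ j)"
    if "l \<in> residue_class j r" for l r k
  proof -
    define q where "q = l div 2 ^ j"
    have l: "l = q * 2 ^ j + r"
      using that div_mult_mod_eq[of l "2 ^ j"] by (auto simp: residue_class_def q_def)
    have "2 * pi * of_int (l * k) / 2 ^ j = 2 * pi * of_int (q * k) + 2 * pi * of_int (r * k) / 2 ^ j"
      unfolding l by (simp add: field_simps)
    moreover have "cis (2 * pi * of_int (q * k)) = 1" by (rule cis_multiple_2pi) simp
    ultimately show ?thesis by (metis cis_mult mult_1)
  qed
  have "(\<Sum>\<^sub>\<infinity>l. d l * cis (2 * pi * of_int (l * k) / 2 ^ j))
    = (\<Sum>r\<in>{0..<2 ^ j}. infsum d (residue_class j r) * cis (2 * pi * of_int (r * k) / 2 ^ j))" for k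
  proof -
    have "(\<lambda>l. d l * cis (2 * pi * of_int (l * k) / 2 ^ j)) summable_on UNIV"
      by (rule abs_summable_summable) (use d in \<open>simp add: norm_mult\<close>)
    from infsum_residue_classes[OF this, of j]
    have "(\<Sum>\<^sub>\<infinity>l. d l * cis (2 * pi * of_int (l * k) / 2 ^ j))
      = (\<Sum>r\<in>{0..<2 ^ j}. \<Sum>\<^sub>\<infinity>l\<in>residue_class j r. d l * cis (2 * pi * of_int (l * k) / 2 ^ j))" .
    also have "\<dots> = (\<Sum>r\<in>{0..<2 ^ j}. \<Sum>\<^sub>\<infinity>l\<in>residue_class j r. d l * cis (2 * pi * of_int (r * k) / 2 ^ j))"
      by (intro sum.cong infsum_cong refl, subst c) auto
    also have "\<dots> = (\<Sum>r\<in>{0..<2 ^ j}. infsum d (residue_class j r) * cis (2 * pi * of_int (r * k) / 2 ^ j))"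
      by (intro sum.cong refl infsum_cmult_left')
    finally show ?thesis .
  qed
  then show ?thesis using dft_Parseval[of "2 ^ j" "\<lambda>r. infsum d (residue_class j r)"] by simp
qed

lemma finite_inj_on_mod_power2:
  fixes F :: "int set"
  assumes F: "finite F"
  shows "\<exists>d. \<forall>j\<ge>d. inj_on (\<lambda>l. l mod 2 ^ j) F"
proof -
  define B where "B = Max (insert 0 (abs ` F))"
  have B: "\<bar>l\<bar> \<le> B" if "l \<in> F" for l
    unfolding B_def using that F by (intro Max_ge) auto
  have "inj_on (\<lambda>l. l mod 2 ^ j) F" if j: "nat (2 * B + 1) \<le> j" for j
  proof (rule inj_onI)
    \<comment> \<open>Two elements of \<open>F\<close> differ by at most \<open>2 * B\<close>; with
      \<open>2 * B + 1 \<le> j\<close> the crude estimate \<open>j < 2 ^ j\<close> separates them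
      without logarithms.\<close>
    have "2 * B + 1 \<le> int j" using j by linarith
    also have "int j < 2 ^ j" using of_nat_less_two_power[of j, where 'a = int] by simp
    finally have big: "2 * B + 1 < 2 ^ j" .
    fix l l' assume *: "l \<in> F" "l' \<in> F" "l mod 2 ^ j = l' mod 2 ^ j"
    then have "2 ^ j dvd l - l'" by (simp add: mod_eq_dvd_iff)
    moreover have "\<bar>l - l'\<bar> < 2 ^ j" using B[OF *(1)] B[OF *(2)] big by linarith
    ultimately show "l = l'" using zdvd_imp_le[of "2 ^ j" "\<bar>l - l'\<bar>"] by fastforce
  qed
  then show ?thesis by blast
qed

section \<open>Energy of a filter cascade\<close>

text \<open>The data of the extension principle at integers: \<open>A j l\<close> stands for the
  value of \<open>m0 (j + 1)\<close> at \<open>l / 2 ^ (j + 1)\<close>, so its index is one below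
  that of the mask, and \<open>H j l\<close> for \<open>\<phi>h j\<close> at \<open>l\<close>.
  Shifts of the mask argument by 1 and 1/2 become shifts of \<open>l\<close> by
  \<open>2 ^ Suc j\<close> and \<open>2 ^ j\<close>.\<close>

locale filter_cascade =
  fixes A H :: "nat \<Rightarrow> int \<Rightarrow> complex"
  assumes A_periodic: "A j (l + 2 ^ Suc j) = A j l"
    and A_qmf: "(cmod (A j l))\<^sup>2 + (cmod (A j (l + 2 ^ j)))\<^sup>2 = 2"
    and refine: "H j l = A j l * H (Suc j) l"
    and H_lim: "(\<lambda>j. complex_of_real (2 powr (real j / 2)) * H j l) \<longlonglongrightarrow> 1"
begin

text \<open>The value of \<open>\<psi>h j\<close> at \<open>l\<close>, with the wavelet mask written
  through \<open>A\<close>.\<close>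

definition G :: "nat \<Rightarrow> int \<Rightarrow> complex" where
  "G j l = cis (2 * pi * (of_int l / 2 ^ Suc j)) * cnj (A j (l + 2 ^ j)) * H (Suc j) l"

definition block_coeff :: "nat \<Rightarrow> (int \<Rightarrow> complex) \<Rightarrow> int \<Rightarrow> complex" where
  "block_coeff j c r = (\<Sum>\<^sub>\<infinity>l\<in>residue_class j r. c l * cnj (H j l))"

definition detail_block :: "nat \<Rightarrow> (int \<Rightarrow> complex) \<Rightarrow> int \<Rightarrow> complex" where
  "detail_block j c r = (\<Sum>\<^sub>\<infinity>l\<in>residue_class j r. c l * cnj (G j l))"

text \<open>The S_j of the overview. Formally this is the energy of \<open>c\<close> against the
  \<open>2 ^ j\<close> translates of the periodized level-j scaling function, put into residue form
  by the discrete Parseval identity; the residue form makes sense without such a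
  periodization.\<close>

definition block_energy :: "nat \<Rightarrow> (int \<Rightarrow> complex) \<Rightarrow> real" where
  "block_energy j c = 2 ^ j * (\<Sum>r\<in>{0..<2 ^ j}. (cmod (block_coeff j c r))\<^sup>2)"

text \<open>Kept in terms of the translates, since the summand for \<open>k\<close> is the squared
  frame coefficient of the wavelet shifted by \<open>k / 2 ^ j\<close>.\<close>

definition detail_energy :: "nat \<Rightarrow> (int \<Rightarrow> complex) \<Rightarrow> real" where
  "detail_energy j c = (\<Sum>k\<in>{0..<2 ^ j}.
     (cmod (\<Sum>\<^sub>\<infinity>l. c l * cnj (cis (- 2 * pi * of_int (l * k) / 2 ^ j) * G j l)))\<^sup>2)"

lemma A_cong:
  assumes "l \<in> residue_class (Suc j) r"
  shows "A j l = A j r"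
proof -
  have nat: "A j (m + int n * 2 ^ Suc j) = A j m" for m n
  proof (induction n)
    case (Suc n)
    have "m + int (Suc n) * 2 ^ Suc j = (m + int n * 2 ^ Suc j) + 2 ^ Suc j"
      by (simp add: algebra_simps)
    then show ?case using A_periodic Suc by metis
  qed simp
  have "A j (m + q * 2 ^ Suc j) = A j m" for m q
  proof (cases "q \<ge> 0")
    case True
    then show ?thesis using nat[of m "nat q"] by simp
  next
    case False
    then show ?thesis using nat[of "m + q * 2 ^ Suc j" "nat (- q)"] by simp
  qed
  from this[of "l mod 2 ^ Suc j" "l div 2 ^ Suc j"] assms show ?thesis
    by (simp only: residue_class_def mem_Collect_eq mod_div_mult_eq)
qed

lemma A_cong_shift:
  assumes "l \<in> residue_class (Suc j) r"
  shows "A j (l + 2 ^ j) = A j (r + 2 ^ j)"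
proof -
  \<comment> \<open>\<open>r + 2 ^ j\<close> need not be a canonical remainder, so both values are
    compared with the one at its reduction.\<close>
  let ?s = "(r + 2 ^ j) mod 2 ^ Suc j"
  have "(l + 2 ^ j) mod 2 ^ Suc j = ?s"
    using assms mod_add_left_eq[of l "2 ^ Suc j" "2 ^ j"] by (simp add: residue_class_def del: power_Suc)
  then have "A j (l + 2 ^ j) = A j ?s" by (intro A_cong) (simp add: residue_class_def)
  moreover have "A j (r + 2 ^ j) = A j ?s" by (intro A_cong) (simp add: residue_class_def)
  ultimately show ?thesis by simp
qed

section \<open>Bounds on the scaling array\<close>

lemma A_le: "(cmod (A j l))\<^sup>2 \<le> 2"
  using A_qmf[of j l] by (smt (verit) zero_le_power2)

lemma H_lim_sq: "(\<lambda>j. 2 ^ j * (cmod (H j l))\<^sup>2) \<longlonglongrightarrow> 1"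
proof -
  have "(\<lambda>j. (cmod (complex_of_real (2 powr (real j / 2)) * H j l))\<^sup>2) \<longlonglongrightarrow> (cmod 1)\<^sup>2"
    by (intro tendsto_intros H_lim)
  moreover have "(cmod (complex_of_real (2 powr (real j / 2)) * H j l))\<^sup>2 = 2 ^ j * (cmod (H j l))\<^sup>2" for j
    by (simp add: norm_mult power_mult_distrib powr_powr powr_realpow flip: powr_numeral)
  ultimately show ?thesis by simp
qed

text \<open>Each refinement step loses at most the factor 2, because a squared mask is at most 2.
  The normalized squares therefore increase with the level and stay below their limit 1.\<close>

lemma H_bound: "2 ^ j * (cmod (H j l))\<^sup>2 \<le> 1"
proof (rule incseq_le[OF _ H_lim_sq])
  show "incseq (\<lambda>j. 2 ^ j * (cmod (H j l))\<^sup>2)"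
  proof (rule incseq_SucI)
    fix n
    have "2 ^ n * (cmod (H n l))\<^sup>2 = (cmod (A n l))\<^sup>2 * (2 ^ n * (cmod (H (Suc n) l))\<^sup>2)"
      unfolding refine[of n l] by (simp add: norm_mult power_mult_distrib)
    also have "\<dots> \<le> 2 * (2 ^ n * (cmod (H (Suc n) l))\<^sup>2)"
      by (intro mult_right_mono A_le) auto
    finally show "2 ^ n * (cmod (H n l))\<^sup>2 \<le> 2 ^ Suc n * (cmod (H (Suc n) l))\<^sup>2" by simp
  qed
qed

text \<open>Downward recursion on the level: for \<open>d\<close> large, \<open>F\<close> meets each residue class modulo \<open>2 ^ (j + d)\<close>
  at most once; going down one level, the two halves of a class are weighted by squared masks of sum \<open>2\<close>.\<close>

lemma H_block_finite_bound:
  assumes "finite F" "F \<subseteq> residue_class j r" "0 \<le> r" "r < 2 ^ j"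
    and "inj_on (\<lambda>l. l mod 2 ^ (j + d)) F"
  shows "2 ^ j * (\<Sum>l\<in>F. (cmod (H j l))\<^sup>2) \<le> 1"
  using assms
proof (induction d arbitrary: j r F)
  case 0
  \<comment> \<open>At depth 0 all elements of \<open>F\<close> have the same remainder and the
    remainder is injective on \<open>F\<close>, so \<open>F\<close> has at most one element and the
    pointwise bound suffices.\<close>
  have "l = l'" if "l \<in> F" "l' \<in> F" for l l'
    using 0(5) that 0(2) by (auto simp: residue_class_def inj_on_def)
  then have "F = {} \<or> (\<exists>l. F = {l})" by blast
  then show ?case using H_bound by auto
next
  case (Suc d)
  let ?F = "\<lambda>s. F \<inter> residue_class (Suc j) s"
  have split: "(\<Sum>l\<in>F. (cmod (H j l))\<^sup>2) = (\<Sum>l\<in>?F r. (cmod (H j l))\<^sup>2) + (\<Sum>l\<in>?F (r + 2 ^ j). (cmod (H j l))\<^sup>2)"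
    using residue_class_Suc[OF Suc.prems(3,4)] Suc.prems(1,2)
    by (subst sum.union_disjoint[symmetric]) (auto intro!: sum.cong)
  have part: "2 ^ j * (\<Sum>l\<in>?F s. (cmod (H j l))\<^sup>2) \<le> (cmod (A j s))\<^sup>2 / 2"
    if "0 \<le> s" "s < 2 ^ Suc j" for s
  proof -
    have IH: "2 ^ Suc j * (\<Sum>l\<in>?F s. (cmod (H (Suc j) l))\<^sup>2) \<le> 1"
      by (rule Suc.IH) (use Suc.prems that in \<open>auto intro: inj_on_subset\<close>)
    have "(\<Sum>l\<in>?F s. (cmod (H j l))\<^sup>2) = (\<Sum>l\<in>?F s. (cmod (A j s))\<^sup>2 * (cmod (H (Suc j) l))\<^sup>2)"
    proof (rule sum.cong[OF refl])
      fix l assume "l \<in> ?F s"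
      then have "A j l = A j s" by (intro A_cong) auto
      then show "(cmod (H j l))\<^sup>2 = (cmod (A j s))\<^sup>2 * (cmod (H (Suc j) l))\<^sup>2"
        by (subst refine) (simp add: norm_mult power_mult_distrib)
    qed
    then have "2 ^ j * (\<Sum>l\<in>?F s. (cmod (H j l))\<^sup>2)
        = (cmod (A j s))\<^sup>2 / 2 * (2 ^ Suc j * (\<Sum>l\<in>?F s. (cmod (H (Suc j) l))\<^sup>2))"
      by (simp add: sum_distrib_left mult_ac)
    also have "\<dots> \<le> (cmod (A j s))\<^sup>2 / 2 * 1"
      by (intro mult_left_mono IH) auto
    finally show ?thesis by simp
  qed
  show ?case
    using part[of r] part[of "r + 2 ^ j"] A_qmf[of j r] Suc.prems(3,4)
    by (simp add: split distrib_left)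
qed

text \<open>The depth at which \<open>F\<close> is separated depends on \<open>F\<close>, but the
  bound 1 does not; hence it passes to the sum over the whole class.\<close>

lemma
  assumes "0 \<le> r" "r < 2 ^ j"
  shows H_block_summable: "(\<lambda>l. (cmod (H j l))\<^sup>2) summable_on residue_class j r"
    and H_block_bound: "2 ^ j * (\<Sum>\<^sub>\<infinity>l\<in>residue_class j r. (cmod (H j l))\<^sup>2) \<le> 1"
proof -
  have fin: "(\<Sum>l\<in>F. (cmod (H j l))\<^sup>2) \<le> 1 / 2 ^ j" if F: "finite F" "F \<subseteq> residue_class j r" for F
  proof -
    obtain d where "inj_on (\<lambda>l. l mod 2 ^ (j + d)) F"
      using finite_inj_on_mod_power2[OF F(1)] by (meson le_add2)
    from H_block_finite_bound[OF F assms this] show ?thesis by (simp add: field_simps)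
  qed
  note * = bounded_finite_sums_imp_summable_on[of _ "\<lambda>l. (cmod (H j l))\<^sup>2", OF _ fin, simplified]
  show "(\<lambda>l. (cmod (H j l))\<^sup>2) summable_on residue_class j r" by (rule *(1))
  show "2 ^ j * (\<Sum>\<^sub>\<infinity>l\<in>residue_class j r. (cmod (H j l))\<^sup>2) \<le> 1" using *(2) by (simp add: field_simps)
qed

lemma H_summable: "(\<lambda>l. (cmod (H j l))\<^sup>2) summable_on UNIV"
proof -
  have "UNIV = (\<Union>r\<in>{0..<2 ^ j}. residue_class j r)" by (auto simp: residue_class_def)
  moreover have "(\<lambda>l. (cmod (H j l))\<^sup>2) summable_on (\<Union>r\<in>{0..<2 ^ j}. residue_class j r)"
    by (rule summable_on_finite_union_disjoint)
       (auto intro!: H_block_summable, auto simp: residue_class_def)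
  ultimately show ?thesis by simp
qed

lemma G_summable: "(\<lambda>l. (cmod (G j l))\<^sup>2) summable_on UNIV"
proof (rule summable_on_comparison_test)
  show "(\<lambda>l. 2 * (cmod (H (Suc j) l))\<^sup>2) summable_on UNIV"
    by (intro summable_on_cmult_right H_summable)
  show "(cmod (G j l))\<^sup>2 \<le> 2 * (cmod (H (Suc j) l))\<^sup>2" for l
    unfolding G_def by (simp add: norm_mult power_mult_distrib A_le mult_right_mono)
qed simp

section \<open>Energy balance between consecutive levels\<close>

context
  fixes c :: "int \<Rightarrow> complex"
  assumes c: "(\<lambda>l. (cmod (c l))\<^sup>2) summable_on UNIV"
begin

lemma coeff_summable_on: "(\<lambda>l. (cmod (c l))\<^sup>2) summable_on I"
  by (rule summable_on_subset_banach[OF c]) auto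

lemma block_summable: "(\<lambda>l. c l * cnj (H j l)) summable_on I"
  by (rule abs_summable_summable,
      rule l2_product_summable_on[OF coeff_summable_on summable_on_subset_banach[OF H_summable]]) simp

text \<open>Cauchy-Schwarz in each residue class: the factor \<open>2 ^ j\<close> is absorbed by the
  bound on the class sums of \<open>H\<close>, and the class sums of \<open>c\<close> add up to its
  full norm.\<close>

lemma block_energy_le: "block_energy j c \<le> (\<Sum>\<^sub>\<infinity>l. (cmod (c l))\<^sup>2)"
proof -
  have "2 ^ j * (cmod (block_coeff j c r))\<^sup>2 \<le> (\<Sum>\<^sub>\<infinity>l\<in>residue_class j r. (cmod (c l))\<^sup>2)"
    if r: "r \<in> {0..<2 ^ j}" for r
  proof -
    have "(cmod (block_coeff j c r))\<^sup>2 \<le> (\<Sum>\<^sub>\<infinity>l\<in>residue_class j r. (cmod (c l))\<^sup>2)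
        * (\<Sum>\<^sub>\<infinity>l\<in>residue_class j r. (cmod (H j l))\<^sup>2)"
      unfolding block_coeff_def
      by (intro l2_Cauchy_Schwarz_infsum coeff_summable_on summable_on_subset_banach[OF H_summable]) auto
    then have "2 ^ j * (cmod (block_coeff j c r))\<^sup>2 \<le> (\<Sum>\<^sub>\<infinity>l\<in>residue_class j r. (cmod (c l))\<^sup>2)
        * (2 ^ j * (\<Sum>\<^sub>\<infinity>l\<in>residue_class j r. (cmod (H j l))\<^sup>2))"
      by (simp add: mult.left_commute)
    also have "\<dots> \<le> (\<Sum>\<^sub>\<infinity>l\<in>residue_class j r. (cmod (c l))\<^sup>2) * 1"
      by (intro mult_left_mono H_block_bound infsum_nonneg) (use r in auto)
    finally show ?thesis by simp
  qed
  then have "block_energy j c \<le> (\<Sum>r\<in>{0..<2 ^ j}. \<Sum>\<^sub>\<infinity>l\<in>residue_class j r. (cmod (c l))\<^sup>2)"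
    unfolding block_energy_def sum_distrib_left by (intro sum_mono)
  also have "\<dots> = (\<Sum>\<^sub>\<infinity>l. (cmod (c l))\<^sup>2)"
    by (rule infsum_residue_classes[OF c, symmetric])
  finally show ?thesis .
qed

text \<open>The mask is constant on classes modulo \<open>2 ^ Suc j\<close>, so after refinement it
  can be pulled out of the sum over each half. This is the low-pass row of the mask matrix.\<close>

lemma block_coeff_Suc:
  assumes r: "0 \<le> r" "r < 2 ^ j"
  shows "block_coeff j c r = cnj (A j r) * block_coeff (Suc j) c r
      + cnj (A j (r + 2 ^ j)) * block_coeff (Suc j) c (r + 2 ^ j)"
proof -
  have part: "(\<Sum>\<^sub>\<infinity>l\<in>residue_class (Suc j) s. c l * cnj (H j l)) = cnj (A j s) * block_coeff (Suc j) c s" for s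
  proof -
    have "(\<Sum>\<^sub>\<infinity>l\<in>residue_class (Suc j) s. c l * cnj (H j l))
      = (\<Sum>\<^sub>\<infinity>l\<in>residue_class (Suc j) s. cnj (A j s) * (c l * cnj (H (Suc j) l)))"
      by (intro infsum_cong, subst refine) (simp add: A_cong)
    then show ?thesis by (simp add: block_coeff_def infsum_cmult_right')
  qed
  show ?thesis
    unfolding block_coeff_def[of j] residue_class_Suc(1)[OF r]
    by (subst infsum_Un_disjoint) (simp_all add: block_summable residue_class_Suc(2)[OF r] part)
qed

lemma detail_summable: "(\<lambda>l. cmod (c l * cnj (G j l))) summable_on I"
  by (rule l2_product_summable_on[OF coeff_summable_on summable_on_subset_banach[OF G_summable]]) simp

text \<open>The high-pass row: the wavelet mask is likewise constant on each half. Going from one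
  half to the other exchanges the two mask values and changes the sign of the phase, which leaves a
  common unimodular factor in front.\<close>

lemma detail_block_eq:
  assumes r: "0 \<le> r" "r < 2 ^ j"
  shows "detail_block j c r = cis (- 2 * pi * (of_int r / 2 ^ Suc j)) *
     (A j (r + 2 ^ j) * block_coeff (Suc j) c r - A j r * block_coeff (Suc j) c (r + 2 ^ j))"
proof -
  have part: "(\<Sum>\<^sub>\<infinity>l\<in>residue_class (Suc j) s. c l * cnj (G j l))
     = cis (- 2 * pi * (of_int s / 2 ^ Suc j)) * A j (s + 2 ^ j) * block_coeff (Suc j) c s" for s
  proof -
    have ph: "cis (2 * pi * (of_int l / 2 ^ Suc j)) = cis (2 * pi * (of_int s / 2 ^ Suc j))"
      if "l \<in> residue_class (Suc j) s" for l
    proof -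
      define q where "q = l div 2 ^ Suc j"
      have l: "l = q * 2 ^ Suc j + s"
        using that div_mult_mod_eq[of l "2 ^ Suc j"] by (auto simp: residue_class_def q_def)
      have "2 * pi * (of_int l / 2 ^ Suc j) = 2 * pi * of_int q + 2 * pi * (of_int s / 2 ^ Suc j)"
        unfolding l by (simp add: field_simps)
      moreover have "cis (2 * pi * of_int q) = 1" by (rule cis_multiple_2pi) simp
      ultimately show ?thesis by (metis cis_mult mult_1)
    qed
    have "(\<Sum>\<^sub>\<infinity>l\<in>residue_class (Suc j) s. c l * cnj (G j l))
      = (\<Sum>\<^sub>\<infinity>l\<in>residue_class (Suc j) s. cis (- 2 * pi * (of_int s / 2 ^ Suc j)) * A j (s + 2 ^ j)
           * (c l * cnj (H (Suc j) l)))"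
      by (intro infsum_cong, unfold G_def, subst ph)
         (simp_all add: A_cong_shift cis_cnj mult_ac)
    then show ?thesis by (simp add: block_coeff_def infsum_cmult_right')
  qed
  \<comment> \<open>Adding \<open>2 ^ j\<close> to the remainder moves the phase by
    \<open>pi\<close>; the resulting minus sign makes the two rows orthogonal.\<close>
  have ph2: "cis (- 2 * pi * (of_int (r + 2 ^ j) / 2 ^ Suc j)) = - cis (- 2 * pi * (of_int r / 2 ^ Suc j))"
  proof -
    have "- 2 * pi * (of_int (r + 2 ^ j) / 2 ^ Suc j) = - 2 * pi * (of_int r / 2 ^ Suc j) + (- pi)"
      by (simp add: field_simps)
    then show ?thesis by (simp only: cis_mult[symmetric]) (simp add: cis.ctr complex_eq_iff)
  qed
  \<comment> \<open>In the second half the shifted mask argument completes a full period, so the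
    mask value there is the one at \<open>r\<close>.\<close>
  have "r + 2 ^ j + 2 ^ j = r + 2 ^ Suc j" by simp
  then have A2: "A j (r + 2 ^ j + 2 ^ j) = A j r" using A_periodic by metis
  have "detail_block j c r = (\<Sum>\<^sub>\<infinity>l\<in>residue_class (Suc j) r. c l * cnj (G j l))
      + (\<Sum>\<^sub>\<infinity>l\<in>residue_class (Suc j) (r + 2 ^ j). c l * cnj (G j l))"
    unfolding detail_block_def residue_class_Suc(1)[OF r]
    by (rule infsum_Un_disjoint[OF abs_summable_summable[OF detail_summable]
          abs_summable_summable[OF detail_summable] residue_class_Suc(2)[OF r]])
  then show ?thesis unfolding part A2 ph2 by (simp add: algebra_simps)
qed

lemma block_energy_Suc: "block_energy j c + detail_energy j c = block_energy (Suc j) c"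
proof -
  have "(\<Sum>\<^sub>\<infinity>l. c l * cnj (cis (- 2 * pi * of_int (l * k) / 2 ^ j) * G j l))
     = (\<Sum>\<^sub>\<infinity>l. c l * cnj (G j l) * cis (2 * pi * of_int (l * k) / 2 ^ j))" for k
    by (intro infsum_cong) (simp add: cis_cnj mult_ac)
  then have "detail_energy j c = 2 ^ j * (\<Sum>r\<in>{0..<2 ^ j}. (cmod (detail_block j c r))\<^sup>2)"
    unfolding detail_energy_def detail_block_def
    using dft_summable_Parseval[OF detail_summable, of j] by simp
  then have "block_energy j c + detail_energy j c
     = 2 ^ j * (\<Sum>r\<in>{0..<2 ^ j}. (cmod (block_coeff j c r))\<^sup>2 + (cmod (detail_block j c r))\<^sup>2)"
    by (simp add: block_energy_def sum.distrib distrib_left)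
  also have "(\<Sum>r\<in>{0..<2 ^ j}. (cmod (block_coeff j c r))\<^sup>2 + (cmod (detail_block j c r))\<^sup>2)
     = (\<Sum>r\<in>{0..<2 ^ j}. 2 * ((cmod (block_coeff (Suc j) c r))\<^sup>2 + (cmod (block_coeff (Suc j) c (r + 2 ^ j)))\<^sup>2))"
  proof (rule sum.cong[OF refl])
    fix r :: int assume "r \<in> {0..<2 ^ j}"
    then have r: "0 \<le> r" "r < 2 ^ j" by auto
    \<comment> \<open>The rows \<open>(cnj a, cnj b)\<close> and \<open>(b, - a)\<close> are
      orthogonal and of equal length. With \<open>a\<close>, \<open>b\<close> the two mask values,
      the squared length is 2, and this 2 turns the weight \<open>2 ^ j\<close> into
      \<open>2 ^ Suc j\<close>.\<close>
    have id: "(cmod (cnj a * x + cnj b * y))\<^sup>2 + (cmod (b * x - a * y))\<^sup>2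
       = ((cmod a)\<^sup>2 + (cmod b)\<^sup>2) * ((cmod x)\<^sup>2 + (cmod y)\<^sup>2)" for a b x y
      unfolding cmod_power2 by (simp add: power2_eq_square algebra_simps)
    show "(cmod (block_coeff j c r))\<^sup>2 + (cmod (detail_block j c r))\<^sup>2
      = 2 * ((cmod (block_coeff (Suc j) c r))\<^sup>2 + (cmod (block_coeff (Suc j) c (r + 2 ^ j)))\<^sup>2)"
      unfolding block_coeff_Suc[OF r] detail_block_eq[OF r]
      by (simp only: norm_mult norm_cis mult_1 id A_qmf)
  qed
  also have "\<dots> = 2 * (\<Sum>r\<in>{0..<2 ^ Suc j}. (cmod (block_coeff (Suc j) c r))\<^sup>2)"
    by (simp add: sum_dyadic_Suc sum_distrib_left del: power_Suc)
  finally show ?thesis by (simp add: block_energy_def)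
qed

lemma block_energy_sum: "block_energy n c = block_energy 0 c + (\<Sum>j<n. detail_energy j c)"
  by (induction n) (simp_all add: block_energy_Suc[symmetric])

end

section \<open>Limit of the level energies\<close>

lemma block_energy_finite_support_ge:
  fixes a :: "int \<Rightarrow> complex"
  assumes F: "finite F" "\<And>l. l \<notin> F \<Longrightarrow> a l = 0" and inj: "inj_on (\<lambda>l. l mod 2 ^ j) F"
  shows "(\<Sum>l\<in>F. (cmod (a l))\<^sup>2 * (2 ^ j * (cmod (H j l))\<^sup>2)) \<le> block_energy j a"
proof -
  \<comment> \<open>At a level that separates \<open>F\<close>, a residue class contains at most one
    point of the support, so no cancellation can occur inside a block.\<close>
  have single: "block_coeff j a (l mod 2 ^ j) = a l * cnj (H j l)" if l: "l \<in> F" for l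
  proof -
    have "block_coeff j a (l mod 2 ^ j) = (\<Sum>\<^sub>\<infinity>m\<in>{l}. a m * cnj (H j m))"
      unfolding block_coeff_def
    proof (rule infsum_cong_neutral)
      fix m assume m: "m \<in> residue_class j (l mod 2 ^ j) - {l}"
      then have "m \<notin> F" using l inj by (auto simp: residue_class_def inj_on_def)
      then show "a m * cnj (H j m) = 0" using F(2) by simp
    qed (auto simp: residue_class_def)
    then show ?thesis by simp
  qed
  have "(\<Sum>l\<in>F. (cmod (a l))\<^sup>2 * (2 ^ j * (cmod (H j l))\<^sup>2))
     = 2 ^ j * (\<Sum>l\<in>F. (cmod (block_coeff j a (l mod 2 ^ j)))\<^sup>2)"
    unfolding sum_distrib_left
    by (intro sum.cong refl) (simp add: single norm_mult power_mult_distrib)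
  also have "(\<Sum>l\<in>F. (cmod (block_coeff j a (l mod 2 ^ j)))\<^sup>2)
     = (\<Sum>r\<in>(\<lambda>l. l mod 2 ^ j) ` F. (cmod (block_coeff j a r))\<^sup>2)"
    by (simp add: sum.reindex[OF inj])
  also have "\<dots> \<le> (\<Sum>r\<in>{0..<2 ^ j}. (cmod (block_coeff j a r))\<^sup>2)"
    by (intro sum_mono2) auto
  finally show ?thesis by (simp add: block_energy_def)
qed

text \<open>The parallelogram law, applied to the parts of \<open>c\<close> on and off \<open>F\<close>.\<close>

lemma block_energy_ge:
  fixes c :: "int \<Rightarrow> complex"
  assumes c: "(\<lambda>l. (cmod (c l))\<^sup>2) summable_on UNIV"
    and F: "finite F" and inj: "inj_on (\<lambda>l. l mod 2 ^ j) F"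
  shows "2 * (\<Sum>l\<in>F. (cmod (c l))\<^sup>2 * (2 ^ j * (cmod (H j l))\<^sup>2)) - (\<Sum>\<^sub>\<infinity>l. (cmod (c l))\<^sup>2)
     \<le> block_energy j c"
proof -
  define a where "a l = (if l \<in> F then c l else 0)" for l
  \<comment> \<open>This is \<open>2 * a - c\<close>: flipping the sign of \<open>c\<close> off
    \<open>F\<close> leaves all moduli unchanged, so the upper bound on the energy of
    \<open>b\<close> is the squared norm of \<open>c\<close> itself.\<close>
  define b where "b l = (if l \<in> F then c l else - c l)" for l
  have b2: "(cmod (b l))\<^sup>2 = (cmod (c l))\<^sup>2" for l by (simp add: b_def)
  have a: "(\<lambda>l. (cmod (a l))\<^sup>2) summable_on UNIV"
    by (rule summable_on_comparison_test[OF c]) (auto simp: a_def)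
  have lin: "block_coeff j b r = 2 * block_coeff j a r - block_coeff j c r" for r
  proof -
    have "block_coeff j b r + block_coeff j c r =
       (\<Sum>\<^sub>\<infinity>l\<in>residue_class j r. b l * cnj (H j l) + c l * cnj (H j l))"
      unfolding block_coeff_def
      by (rule infsum_add[symmetric]) (rule block_summable, simp add: b2 c)+
    also have "\<dots> = (\<Sum>\<^sub>\<infinity>l\<in>residue_class j r. 2 * (a l * cnj (H j l)))"
      by (intro infsum_cong) (simp add: a_def b_def)
    also have "\<dots> = 2 * block_coeff j a r"
      unfolding block_coeff_def by (rule infsum_cmult_right')
    finally show ?thesis by (simp add: algebra_simps)
  qed
  have par: "2 * (cmod y)\<^sup>2 \<le> (cmod x)\<^sup>2 + (cmod (2 * y - x))\<^sup>2" for x y :: complex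
  proof -
    have "(cmod x)\<^sup>2 + (cmod (2 * y - x))\<^sup>2 = 2 * (cmod y)\<^sup>2 + 2 * (cmod (x - y))\<^sup>2"
      unfolding cmod_power2 by (simp add: power2_eq_square algebra_simps)
    then show ?thesis by simp
  qed
  have "2 * block_energy j a \<le> block_energy j c + block_energy j b"
    unfolding block_energy_def distrib_left[symmetric] sum.distrib[symmetric]
    by (simp add: lin mult.left_commute[of 2] sum_distrib_left)
       (intro sum_mono mult_left_mono par, simp)
  moreover have "block_energy j b \<le> (\<Sum>\<^sub>\<infinity>l. (cmod (c l))\<^sup>2)"
    using block_energy_le[of b j] by (simp add: b2 c)
  moreover have "(\<Sum>l\<in>F. (cmod (c l))\<^sup>2 * (2 ^ j * (cmod (H j l))\<^sup>2)) \<le> block_energy j a"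
    using block_energy_finite_support_ge[OF F _ inj, of a] by (simp add: a_def)
  ultimately show ?thesis by linarith
qed

lemma block_energy_lim:
  assumes c: "(\<lambda>l. (cmod (c l))\<^sup>2) summable_on UNIV"
  shows "(\<lambda>j. block_energy j c) \<longlonglongrightarrow> (\<Sum>\<^sub>\<infinity>l. (cmod (c l))\<^sup>2)"
proof (rule order_tendstoI)
  let ?T = "\<Sum>\<^sub>\<infinity>l. (cmod (c l))\<^sup>2"
  show "eventually (\<lambda>j. block_energy j c < u) sequentially" if "?T < u" for u
    by (rule always_eventually) (use le_less_trans[OF block_energy_le[OF c] that] in blast)
  fix u assume u: "u < ?T"
  \<comment> \<open>The threshold is chosen so that a partial sum above it makes twice that sum
    minus \<open>?T\<close>, the limit of the lower bound on the energy, exceed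
    \<open>u\<close>.\<close>
  then have less: "(u + ?T) / 2 < ?T" by simp
  have "((\<lambda>l. (cmod (c l))\<^sup>2) has_sum ?T) UNIV" by (rule has_sum_infsum[OF c])
  then have "(sum (\<lambda>l. (cmod (c l))\<^sup>2) \<longlongrightarrow> ?T) (finite_subsets_at_top UNIV)"
    unfolding has_sum_def .
  from order_tendstoD(1)[OF this less]
  obtain F where F: "finite F" "(u + ?T) / 2 < (\<Sum>l\<in>F. (cmod (c l))\<^sup>2)"
    unfolding eventually_finite_subsets_at_top by blast
  have term_lim: "(\<lambda>j. (cmod (c l))\<^sup>2 * (2 ^ j * (cmod (H j l))\<^sup>2)) \<longlonglongrightarrow> (cmod (c l))\<^sup>2 * 1" for l
    by (intro tendsto_mult tendsto_const H_lim_sq)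
  have "(\<lambda>j. \<Sum>l\<in>F. (cmod (c l))\<^sup>2 * (2 ^ j * (cmod (H j l))\<^sup>2)) \<longlonglongrightarrow> (\<Sum>l\<in>F. (cmod (c l))\<^sup>2 * 1)"
    by (rule tendsto_sum[OF term_lim])
  then have tend: "(\<lambda>j. 2 * (\<Sum>l\<in>F. (cmod (c l))\<^sup>2 * (2 ^ j * (cmod (H j l))\<^sup>2)) - ?T)
     \<longlonglongrightarrow> 2 * (\<Sum>l\<in>F. (cmod (c l))\<^sup>2 * 1) - ?T"
    by (intro tendsto_diff tendsto_mult_left tendsto_const)
  have "u < 2 * (\<Sum>l\<in>F. (cmod (c l))\<^sup>2 * 1) - ?T" using F(2) by simp
  from order_tendstoD(1)[OF tend this] have ev: "eventually (\<lambda>j. u < 2 * (\<Sum>l\<in>F. (cmod (c l))\<^sup>2 * (2 ^ j * (cmod (H j l))\<^sup>2)) - ?T) sequentially" .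
  obtain d where "\<forall>j\<ge>d. inj_on (\<lambda>l. l mod 2 ^ j) F" using finite_inj_on_mod_power2[OF F(1)] by blast
  then have "eventually (\<lambda>j. inj_on (\<lambda>l. l mod 2 ^ j) F) sequentially"
    unfolding eventually_at_top_linorder by blast
  with ev show "eventually (\<lambda>j. u < block_energy j c) sequentially"
  proof eventually_elim
    case (elim j)
    then show ?case using block_energy_ge[OF c F(1) elim(2)] by (rule_tac less_le_trans)
  qed
qed

text \<open>The Fourier coefficients that the periodized frame elements will turn out to have; the
  unimodular factor comes from the translation by \<open>k / 2 ^ j\<close>.\<close>

fun system_coeff :: "wavelet_index \<Rightarrow> int \<Rightarrow> complex" where
  "system_coeff Scaling l = H 0 l"
| "system_coeff (Wavelet j k) l = cis (- 2 * pi * of_int (l * k) / 2 ^ j) * G j l"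

lemma cascade_Parseval:
  assumes c: "(\<lambda>l. (cmod (c l))\<^sup>2) summable_on UNIV"
  shows "((\<lambda>i. (cmod (\<Sum>\<^sub>\<infinity>l. c l * cnj (system_coeff i l)))\<^sup>2) has_sum (\<Sum>\<^sub>\<infinity>l. (cmod (c l))\<^sup>2)) periodic_indices"
proof -
  let ?T = "\<Sum>\<^sub>\<infinity>l. (cmod (c l))\<^sup>2"
  let ?f = "\<lambda>i. (cmod (\<Sum>\<^sub>\<infinity>l. c l * cnj (system_coeff i l)))\<^sup>2"
  let ?W = "\<lambda>(j, k). Wavelet j k"
  have partial: "block_energy n c - block_energy 0 c = (\<Sum>j<n. detail_energy j c)" for n
    using block_energy_sum[OF c, of n] by linarith
  have "(\<lambda>n. block_energy n c - block_energy 0 c) \<longlonglongrightarrow> ?T - block_energy 0 c"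
    by (intro tendsto_intros block_energy_lim c)
  then have "(\<lambda>j. detail_energy j c) sums (?T - block_energy 0 c)"
    unfolding sums_def partial .
  \<comment> \<open>Nonnegativity upgrades the telescoped series to an unordered sum, as needed for
    summation over pairs of level and translate.\<close>
  then have outer: "((\<lambda>j. detail_energy j c) has_sum (?T - block_energy 0 c)) UNIV"
    by (rule sums_nonneg_imp_has_sum) (simp add: detail_energy_def sum_nonneg)
  have inner: "((\<lambda>k. (?f \<circ> ?W) (j, k)) has_sum detail_energy j c) {0..<2 ^ j}" for j
    by (rule has_sum_finiteI) (simp_all add: detail_energy_def)
  have "((?f \<circ> ?W) has_sum (?T - block_energy 0 c)) (Sigma UNIV (\<lambda>j. {0..<2 ^ j}))"
    by (rule has_sum_SigmaI[OF inner outer])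
       (rule summable_on_SigmaI[OF inner], use outer in \<open>auto simp: summable_on_def\<close>)
  moreover have "inj_on ?W (Sigma UNIV (\<lambda>j. {0..<2 ^ j}))" by (auto simp: inj_on_def)
  ultimately have "(?f has_sum (?T - block_energy 0 c)) (?W ` Sigma UNIV (\<lambda>j. {0..<2 ^ j}))"
    by (simp add: has_sum_reindex)
  then have "(?f has_sum (?f Scaling + (?T - block_energy 0 c))) (insert Scaling (?W ` Sigma UNIV (\<lambda>j. {0..<2 ^ j})))"
    by (intro has_sum_insert) auto
  \<comment> \<open>Modulo \<open>2 ^ 0\<close> there is a single residue class, so the level-0
    energy is the one scaling coefficient and cancels the subtracted term.\<close>
  moreover have "?f Scaling = block_energy 0 c"
    by (simp add: block_energy_def block_coeff_def residue_class_def)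
  moreover have "insert Scaling (?W ` Sigma UNIV (\<lambda>j. {0..<2 ^ j})) = periodic_indices"
    by (force simp: periodic_indices_def)
  ultimately show ?thesis by simp
qed

lemma system_coeff_summable: "(\<lambda>l. (cmod (system_coeff i l))\<^sup>2) summable_on UNIV"
proof (cases i)
  case Scaling
  then show ?thesis using H_summable by simp
next
  case (Wavelet j k)
  then have "cmod (system_coeff i l) = cmod (G j l)" for l by (simp add: norm_mult)
  then show ?thesis using G_summable by presburger
qed

end

section \<open>Trigonometric polynomials\<close>

definition circle_char :: "int \<Rightarrow> real \<Rightarrow> complex" where
  "circle_char l x = cis (2 * pi * of_int l * x)"

lemma circle_char_mult: "circle_char l x * circle_char m x = circle_char (l + m) x"
  by (simp add: circle_char_def cis_mult algebra_simps)

lemma cnj_circle_char: "cnj (circle_char l x) = circle_char (- l) x"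
  by (simp add: circle_char_def cis_cnj)

lemma norm_circle_char [simp]: "cmod (circle_char l x) = 1"
  by (simp add: circle_char_def)

lemma circle_char_0 [simp]: "circle_char 0 x = 1"
  by (simp add: circle_char_def)

lemma continuous_on_circle_char: "continuous_on S (circle_char l)"
  unfolding circle_char_def[abs_def] by (intro continuous_intros)

lemma circle_char_measurable [measurable]: "circle_char l \<in> borel_measurable (lebesgue_on S)"
proof -
  have "circle_char l \<in> borel_measurable lebesgue"
    by (rule continuous_imp_measurable_on_sets_lebesgue[OF continuous_on_circle_char, of UNIV, simplified lebesgue_on_UNIV_eq]) simp
  then show ?thesis by (rule measurable_restrict_space1)
qed

definition trig_poly :: "(real \<Rightarrow> complex) \<Rightarrow> bool" where
  "trig_poly p \<longleftrightarrow> (\<exists>F a. finite F \<and> p = (\<lambda>x. \<Sum>l\<in>F. a l * circle_char l x))"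

lemma trig_poly_char: "trig_poly (\<lambda>x. a * circle_char l x)"
  unfolding trig_poly_def by (rule exI[of _ "{l}"]) auto

lemma trig_poly_const: "trig_poly (\<lambda>x. a)"
  using trig_poly_char[of a 0] by simp

lemma trig_poly_add:
  assumes "trig_poly p" "trig_poly q"
  shows "trig_poly (\<lambda>x. p x + q x)"
proof -
  obtain F a where F: "finite F" "p = (\<lambda>x. \<Sum>l\<in>F. a l * circle_char l x)"
    using assms(1) by (auto simp: trig_poly_def)
  obtain G b where G: "finite G" "q = (\<lambda>x. \<Sum>l\<in>G. b l * circle_char l x)"
    using assms(2) by (auto simp: trig_poly_def)
  define c where "c l = (if l \<in> F then a l else 0) + (if l \<in> G then b l else 0)" for l
  have "p x = (\<Sum>l\<in>F \<union> G. (if l \<in> F then a l else 0) * circle_char l x)" for x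
    unfolding F(2) by (rule sum.mono_neutral_cong_left) (use F(1) G(1) in auto)
  moreover have "q x = (\<Sum>l\<in>F \<union> G. (if l \<in> G then b l else 0) * circle_char l x)" for x
    unfolding G(2) by (rule sum.mono_neutral_cong_left) (use F(1) G(1) in auto)
  ultimately have "p x + q x = (\<Sum>l\<in>F \<union> G. c l * circle_char l x)" for x
    by (simp only: c_def distrib_right sum.distrib)
  then show ?thesis
    unfolding trig_poly_def using F(1) G(1) by (intro exI[of _ "F \<union> G"] exI[of _ c]) auto
qed

lemma trig_poly_sum:
  assumes "finite I" "\<And>i. i \<in> I \<Longrightarrow> trig_poly (p i)"
  shows "trig_poly (\<lambda>x. \<Sum>i\<in>I. p i x)"
  using assms by (induction I rule: finite_induct) (auto intro: trig_poly_const trig_poly_add)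

lemma trig_poly_mult:
  assumes "trig_poly p" "trig_poly q"
  shows "trig_poly (\<lambda>x. p x * q x)"
proof -
  obtain F a where F: "finite F" "p = (\<lambda>x. \<Sum>l\<in>F. a l * circle_char l x)"
    using assms(1) by (auto simp: trig_poly_def)
  obtain G b where G: "finite G" "q = (\<lambda>x. \<Sum>l\<in>G. b l * circle_char l x)"
    using assms(2) by (auto simp: trig_poly_def)
  have "p x * q x = (\<Sum>l\<in>F. \<Sum>m\<in>G. (a l * b m) * circle_char (l + m) x)" for x
    unfolding F(2) G(2) sum_product circle_char_mult[symmetric] by (simp add: mult_ac)
  then show ?thesis using F(1) G(1) by (auto intro!: trig_poly_sum trig_poly_char)
qed

text \<open>A real-linear function of \<open>z\<close> is a combination of \<open>Re z\<close> and
  \<open>Im z\<close>, which on the circle are cosine and sine, hence combinations of the characters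
  of frequency 1 and -1. Closure under sums and products handles the remaining cases.\<close>

lemma trig_poly_real_polynomial_function:
  assumes "real_polynomial_function f"
  shows "trig_poly (\<lambda>x. complex_of_real (f (cis (2 * pi * x))))"
  using assms
proof (induction rule: real_polynomial_function.induct)
  case (linear f)
  interpret bounded_linear f by fact
  have f_eq: "f z = Re z * f 1 + Im z * f \<i>" for z
  proof -
    have "z = Re z *\<^sub>R 1 + Im z *\<^sub>R \<i>" by (simp add: complex_eq_iff)
    then have "f z = f (Re z *\<^sub>R 1 + Im z *\<^sub>R \<i>)" by (rule arg_cong)
    then show ?thesis by (simp only: add scaleR real_scaleR_def)
  qed
  have cos_eq: "complex_of_real (cos t) = (1 / 2) * cis t + (1 / 2) * cis (- t)"
    and sin_eq: "complex_of_real (sin t) = (- \<i> / 2) * cis t + (\<i> / 2) * cis (- t)" for t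
    by (simp_all add: complex_eq_iff)
  have "complex_of_real (f (cis (2 * pi * x)))
      = of_real (f 1) * ((1 / 2) * circle_char 1 x + (1 / 2) * circle_char (- 1) x)
        + of_real (f \<i>) * ((- \<i> / 2) * circle_char 1 x + (\<i> / 2) * circle_char (- 1) x)" for x
    unfolding f_eq[of "cis _"] of_real_add of_real_mult cis.sel cos_eq sin_eq
    by (simp add: circle_char_def)
  then show ?case
    by (simp only:) (rule trig_poly_add trig_poly_mult trig_poly_const trig_poly_char)+
next
  case (const c)
  show ?case by (rule trig_poly_const)
next
  case (add f g)
  then show ?case by (simp add: trig_poly_add)
next
  case (mult f g)
  then show ?case by (simp add: trig_poly_mult)
qed

lemma trig_poly_polynomial_function:
  fixes g :: "complex \<Rightarrow> complex"
  assumes "polynomial_function g"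
  shows "trig_poly (\<lambda>x. g (cis (2 * pi * x)))"
proof -
  have "real_polynomial_function (\<lambda>z. Re (g z))" "real_polynomial_function (\<lambda>z. Im (g z))"
    using assms bounded_linear_Re bounded_linear_Im unfolding polynomial_function_def o_def by blast+
  then have "trig_poly (\<lambda>x. complex_of_real (Re (g (cis (2 * pi * x)))) + \<i> * complex_of_real (Im (g (cis (2 * pi * x)))))"
    by (intro trig_poly_add trig_poly_mult[OF trig_poly_const] trig_poly_real_polynomial_function)
  then show ?thesis by (simp flip: complex_eq)
qed

section \<open>Approximation on the unit interval by trigonometric polynomials\<close>

lemma trig_poly_uniform_approx:
  fixes u :: "complex \<Rightarrow> complex"
  assumes "continuous_on (sphere 0 1) u" "0 < e"
  shows "\<exists>p. trig_poly p \<and> (\<forall>x. cmod (u (cis (2 * pi * x)) - p x) < e)"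
proof -
  obtain g where g: "polynomial_function g" "\<And>z. z \<in> sphere 0 1 \<Longrightarrow> cmod (u z - g z) < e"
    using Stone_Weierstrass_polynomial_function[OF compact_sphere assms] by blast
  show ?thesis
    by (rule exI[of _ "\<lambda>x. g (cis (2 * pi * x))"]) (use g trig_poly_polynomial_function in auto)
qed

text \<open>Transplanting a function on \<open>[0, 1]\<close> to the circle creates a jump at \<open>1\<close>; the factor
  \<open>min 1 (n * cmod (z - 1))\<close> removes it.\<close>

lemma continuous_on_circle_transplant:
  fixes g :: "real \<Rightarrow> complex"
  assumes g: "continuous_on UNIV g" and B: "\<And>x. cmod (g x) \<le> B"
  shows "continuous_on (sphere 0 1)
           (\<lambda>z. of_real (min 1 (real n * cmod (z - 1))) * g (Arg2pi z / (2 * pi)))"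
    (is "continuous_on _ ?u")
  unfolding continuous_on_eq_continuous_within
proof
  fix z :: complex assume z: "z \<in> sphere 0 1"
  show "continuous (at z within sphere 0 1) ?u"
  proof (cases "z = 1")
    case True
    \<comment> \<open>At 1 the argument jumps, but \<open>g\<close> stays bounded by
      \<open>B\<close> and the factor tends to 0.\<close>
    have "(?u \<longlongrightarrow> 0) (at 1)"
    proof (rule Lim_null_comparison)
      have "cmod (?u w) \<le> real n * cmod (w - 1) * B" for w
        unfolding norm_mult norm_of_real by (rule mult_mono[OF _ B]) auto
      then show "\<forall>\<^sub>F w in at 1. cmod (?u w) \<le> real n * cmod (w - 1) * B"
        by (rule eventuallyI)
      show "((\<lambda>w. real n * cmod (w - 1) * B) \<longlongrightarrow> 0) (at 1)"
        by (auto intro!: tendsto_eq_intros)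
    qed
    then have "isCont ?u 1" by (simp add: isCont_def)
    then show ?thesis using True continuous_at_imp_continuous_at_within by blast
  next
    case False
    \<comment> \<open>\<open>Arg2pi\<close> is continuous off the nonnegative real axis, and the
      circle meets that axis only at 1.\<close>
    have "z \<notin> \<real>\<^sub>\<ge>\<^sub>0"
    proof
      assume "z \<in> \<real>\<^sub>\<ge>\<^sub>0"
      then obtain r where "z = of_real r" "r \<ge> 0" by (auto elim: nonneg_Reals_cases)
      then show False using z False by simp
    qed
    then have "isCont (\<lambda>z. Arg2pi z / (2 * pi)) z"
      by (intro continuous_intros continuous_at_Arg2pi) auto
    moreover have "isCont g (Arg2pi z / (2 * pi))"
      using g by (simp add: continuous_on_eq_continuous_at)
    ultimately have "isCont (\<lambda>z. g (Arg2pi z / (2 * pi))) z"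
      by (rule isCont_o2)
    then have "isCont ?u z" by (intro continuous_intros)
    then show ?thesis using continuous_at_imp_continuous_at_within by blast
  qed
qed

text \<open>A measurable function is almost everywhere a limit of continuous ones; these are clipped
  to the disc of radius \<open>B\<close>, moved to the circle, and approximated within
  \<open>1 / (n + 1)\<close>. The bound \<open>B + 1\<close>, uniform in \<open>n\<close>, is there
  for dominated convergence.\<close>

lemma bounded_measurable_trig_poly_approx:
  fixes h :: "real \<Rightarrow> complex"
  assumes h: "h \<in> borel_measurable (lebesgue_on {0..1})" and B: "\<And>x. cmod (h x) \<le> B"
  obtains p where "\<And>n::nat. trig_poly (p n)" "\<And>n x. cmod (p n x) \<le> B + 1"
    "AE x in lebesgue_on {0..1}. (\<lambda>n. p n x) \<longlonglongrightarrow> h x"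
proof -
  have "B \<ge> 0" using B[of 0] norm_ge_zero order_trans by blast
  have "h measurable_on {0..1}"
    using h by (simp add: measurable_on_iff_borel_measurable)
  then obtain N g where N: "negligible N" and g: "\<And>n. continuous_on UNIV (g n)"
    and lim: "\<And>x. x \<notin> N \<Longrightarrow> (\<lambda>n. g n x) \<longlonglongrightarrow> (if x \<in> {0..1} then h x else 0)"
    unfolding measurable_on_def by blast
  \<comment> \<open>Clipping by nearest-point projection is continuous and fixes the values of
    \<open>h\<close>, so it imposes the bound without disturbing the limit.\<close>
  let ?c = "closest_point (cball (0::complex) B)"
  have cont: "continuous_on UNIV ?c"
    using \<open>B \<ge> 0\<close> by (intro continuous_on_closest_point) auto
  have c_bound: "cmod (?c z) \<le> B" for z
    using closest_point_in_set[of "cball 0 B" z] \<open>B \<ge> 0\<close> by auto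
  have gc: "continuous_on UNIV (\<lambda>x. ?c (g n x))" for n
    using continuous_on_compose2[OF cont g[of n]] by simp
  define u where "u n z = of_real (min 1 (real n * cmod (z - 1))) * ?c (g n (Arg2pi z / (2 * pi)))" for n z
  have "continuous_on (sphere 0 1) (u n)" for n
    unfolding u_def by (rule continuous_on_circle_transplant[OF gc c_bound])
  then have "\<forall>n. \<exists>p. trig_poly p \<and> (\<forall>x. cmod (u n (cis (2 * pi * x)) - p x) < inverse (real (Suc n)))"
    by (intro allI trig_poly_uniform_approx) simp_all
  then obtain p where "\<forall>n. trig_poly (p n) \<and> (\<forall>x. cmod (u n (cis (2 * pi * x)) - p n x) < inverse (real (Suc n)))"
    by (rule choice[THEN exE])
  then have p: "\<And>n. trig_poly (p n)"
    "\<And>n x. cmod (u n (cis (2 * pi * x)) - p n x) < inverse (real (Suc n))"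
    by blast+
  have u_bound: "cmod (u n z) \<le> B" for n z
  proof -
    have "cmod (u n z) \<le> 1 * B"
      unfolding u_def norm_mult by (intro mult_mono c_bound) auto
    then show ?thesis by simp
  qed
  have p_bound: "cmod (p n x) \<le> B + 1" for n x
  proof -
    have "cmod (p n x) \<le> cmod (u n (cis (2 * pi * x))) + cmod (u n (cis (2 * pi * x)) - p n x)"
      by (metis norm_minus_commute norm_triangle_sub)
    also have "\<dots> \<le> B + inverse (real (Suc n))" by (intro add_mono u_bound less_imp_le p)
    also have "inverse (real (Suc n)) \<le> 1" by (simp add: field_simps)
    finally show ?thesis by simp
  qed
  \<comment> \<open>Both endpoints are sent to the point 1 of the circle, where the factor in
    \<open>u\<close> vanishes for every \<open>n\<close>; at any other point this factor equals 1
    from some \<open>n\<close> on.\<close>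
  have p_lim: "(\<lambda>n. p n x) \<longlonglongrightarrow> h x" if x: "x \<in> {0..1}" "x \<notin> N \<union> {0, 1}" for x
  proof -
    have x01: "0 < x" "x < 1" using x by auto
    let ?z = "cis (2 * pi * x)"
    have arg: "Arg2pi ?z = 2 * pi * x"
      using x01 by (intro Arg2pi_unique[of 1]) (auto simp: cis_conv_exp)
    have "?z \<noteq> 1" using arg x01 by (metis Arg2pi_of_real less_irrefl mult_pos_pos of_real_1 pi_gt_zero zero_less_numeral not_one_less_zero)
    then have z1: "cmod (?z - 1) > 0" by simp
    have "(\<lambda>n. ?c (g n x)) \<longlonglongrightarrow> ?c (h x)"
      using lim[of x] x cont by (intro continuous_on_tendsto_compose[OF cont]) auto
    moreover have "?c (h x) = h x" using B by (intro closest_point_self) auto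
    moreover have "eventually (\<lambda>n. u n ?z = ?c (g n x)) sequentially"
    proof -
      obtain m :: nat where m: "1 < real m * cmod (?z - 1)" using reals_Archimedean3[OF z1] by blast
      have "u n ?z = ?c (g n x)" if "m \<le> n" for n
      proof -
        have "real m * cmod (?z - 1) \<le> real n * cmod (?z - 1)" using that by (intro mult_right_mono) auto
        then show ?thesis using m by (simp add: u_def arg)
      qed
      then show ?thesis unfolding eventually_sequentially by blast
    qed
    ultimately have ulim: "(\<lambda>n. u n ?z) \<longlonglongrightarrow> h x"
      using tendsto_cong by fastforce
    have "(\<lambda>n. u n ?z - p n x) \<longlonglongrightarrow> 0"
      by (rule Lim_null_comparison[OF always_eventually[OF allI[OF less_imp_le[OF p(2)]]]
            LIMSEQ_inverse_real_of_nat])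
    from tendsto_diff[OF ulim this] show ?thesis by simp
  qed
  have "N \<union> {0, 1} \<in> null_sets lebesgue"
    using N by (simp add: negligible_iff_null_sets[symmetric] negligible_Un_eq)
  then have "AE x in lebesgue. x \<notin> N \<union> {0, 1}" by (rule AE_not_in)
  then have "AE x in lebesgue_on {0..1}. x \<notin> N \<union> {0, 1}"
    by (subst AE_restrict_space_iff) auto
  then have "AE x in lebesgue_on {0..1}. (\<lambda>n. p n x) \<longlonglongrightarrow> h x"
    using AE_space[of "lebesgue_on {0..1}"] by eventually_elim (use p_lim in auto)
  with p(1) p_bound show ?thesis by (rule that)
qed

section \<open>Fourier series of square-integrable functions\<close>

text \<open>On \<open>lebesgue_on {0..1}\<close> this describes a function on one period only, so no
  periodic extension has to be carried along.\<close>

definition square_integrable :: "'a measure \<Rightarrow> ('a \<Rightarrow> complex) \<Rightarrow> bool" where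
  "square_integrable M f \<longleftrightarrow> f \<in> borel_measurable M \<and> integrable M (\<lambda>x. (cmod (f x))\<^sup>2)"

lemma square_integrable_measurable: "square_integrable M f \<Longrightarrow> f \<in> borel_measurable M"
  by (simp add: square_integrable_def)

lemma borel_measurable_cnj [measurable]:
  "f \<in> borel_measurable M \<Longrightarrow> (\<lambda>x. cnj (f x)) \<in> borel_measurable M"
  by (erule measurable_compose[where g = cnj], rule borel_measurable_continuous_onI)
     (intro continuous_intros)

lemma two_mult_cmod_le: "2 * (cmod a * cmod b) \<le> (cmod a)\<^sup>2 + (cmod b)\<^sup>2"
  using sum_squares_bound[of "cmod a" "cmod b"] by simp

lemma square_integrable_mult:
  assumes f: "square_integrable M f" and g: "square_integrable M g"
  shows "integrable M (\<lambda>x. f x * cnj (g x))"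
proof (rule Bochner_Integration.integrable_bound)
  show "integrable M (\<lambda>x. (cmod (f x))\<^sup>2 + (cmod (g x))\<^sup>2)"
    using f g by (simp add: square_integrable_def)
  have [measurable]: "f \<in> borel_measurable M" "g \<in> borel_measurable M"
    using f g by (simp_all add: square_integrable_def)
  show "(\<lambda>x. f x * cnj (g x)) \<in> borel_measurable M" by measurable
  have "cmod (f x * cnj (g x)) \<le> (cmod (f x))\<^sup>2 + (cmod (g x))\<^sup>2" for x
    using two_mult_cmod_le[of "f x" "g x"] mult_nonneg_nonneg[OF norm_ge_zero[of "f x"] norm_ge_zero[of "g x"]]
    unfolding norm_mult complex_mod_cnj by linarith
  then show "AE x in M. norm (f x * cnj (g x)) \<le> norm ((cmod (f x))\<^sup>2 + (cmod (g x))\<^sup>2)"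
    by (intro AE_I2) simp
qed

lemma cmod_add_power2_le: "(cmod (a + b))\<^sup>2 \<le> 2 * (cmod a)\<^sup>2 + 2 * (cmod b)\<^sup>2"
proof -
  have "(cmod (a + b))\<^sup>2 \<le> (cmod a + cmod b)\<^sup>2" by (intro power_mono norm_triangle_ineq) simp
  also have "\<dots> \<le> 2 * (cmod a)\<^sup>2 + 2 * (cmod b)\<^sup>2"
    using two_mult_cmod_le[of a b] by (simp add: power2_sum)
  finally show ?thesis .
qed

lemma square_integrable_add:
  assumes f: "square_integrable M f" and g: "square_integrable M g"
  shows "square_integrable M (\<lambda>x. f x + g x)"
  unfolding square_integrable_def
proof
  have [measurable]: "f \<in> borel_measurable M" "g \<in> borel_measurable M"
    using f g by (simp_all add: square_integrable_def)
  show "(\<lambda>x. f x + g x) \<in> borel_measurable M" by measurable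
  show "integrable M (\<lambda>x. (cmod (f x + g x))\<^sup>2)"
  proof (rule Bochner_Integration.integrable_bound)
    show "integrable M (\<lambda>x. 2 * (cmod (f x))\<^sup>2 + 2 * (cmod (g x))\<^sup>2)"
      using f g by (simp add: square_integrable_def)
    show "(\<lambda>x. (cmod (f x + g x))\<^sup>2) \<in> borel_measurable M" by measurable
    show "AE x in M. norm ((cmod (f x + g x))\<^sup>2) \<le> norm (2 * (cmod (f x))\<^sup>2 + 2 * (cmod (g x))\<^sup>2)"
      using cmod_add_power2_le by (intro AE_I2) simp
  qed
qed

lemma square_integrable_cmult:
  assumes f: "square_integrable M f"
  shows "square_integrable M (\<lambda>x. a * f x)"
proof -
  have "f \<in> borel_measurable M" using f by (rule square_integrable_measurable)
  then have "(\<lambda>x. a * f x) \<in> borel_measurable M" by measurable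
  with f show ?thesis by (simp add: square_integrable_def norm_mult power_mult_distrib)
qed

lemma square_integrable_diff:
  assumes f: "square_integrable M f" and g: "square_integrable M g"
  shows "square_integrable M (\<lambda>x. f x - g x)"
  using square_integrable_add[OF f square_integrable_cmult[OF g, of "-1"]] by simp

lemma (in finite_measure) bounded_square_integrable:
  assumes "f \<in> borel_measurable M" "\<And>x. cmod (f x) \<le> B"
  shows "square_integrable M f"
  unfolding square_integrable_def
proof
  have [measurable]: "f \<in> borel_measurable M" by fact
  have "(cmod (f x))\<^sup>2 \<le> B\<^sup>2" for x using assms(2) by (intro power_mono) auto
  then show "integrable M (\<lambda>x. (cmod (f x))\<^sup>2)"
    by (intro integrable_const_bound[where B = "B\<^sup>2"]) auto
qed fact

interpretation unit_interval: finite_measure "lebesgue_on {0..1::real}"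
  by (rule finite_measure_lebesgue_on) simp

abbreviation L2_unit :: "(real \<Rightarrow> complex) \<Rightarrow> bool" where
  "L2_unit \<equiv> square_integrable (lebesgue_on {0..1})"

lemma square_integrable_circle_char: "L2_unit (circle_char l)"
  by (rule unit_interval.bounded_square_integrable[where B = 1]) simp_all

lemma square_integrable_trig_poly:
  assumes "trig_poly p"
  shows "L2_unit p"
proof -
  obtain F a where F: "finite F" "p = (\<lambda>x. \<Sum>l\<in>F. a l * circle_char l x)"
    using assms by (auto simp: trig_poly_def)
  have "L2_unit (\<lambda>x. 0)" by (simp add: square_integrable_def)
  with F(1) show ?thesis
    unfolding F(2)
  proof (induction F rule: finite_induct)
    case (insert l F)
    have "L2_unit (\<lambda>x. a l * circle_char l x)"
      by (intro square_integrable_cmult square_integrable_circle_char)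
    from square_integrable_add[OF this insert.IH[OF insert.prems]] show ?case
      using insert.hyps by simp
  qed simp
qed

section \<open>Orthonormality of the characters\<close>

definition fourier_coeff :: "(real \<Rightarrow> complex) \<Rightarrow> int \<Rightarrow> complex" where
  "fourier_coeff f l = inner_T f (circle_char l)"

lemma inner_T_self:
  "inner_T f f = complex_of_real (LINT x|lebesgue_on {0..1}. (cmod (f x))\<^sup>2)"
  by (simp add: inner_T_def complex_norm_square[symmetric] flip: integral_complex_of_real)

lemma inner_T_commute: "inner_T g f = cnj (inner_T f g)"
proof -
  have "inner_T g f = (LINT x|lebesgue_on {0..1}. cnj (f x * cnj (g x)))"
    by (simp add: inner_T_def mult.commute)
  then show ?thesis unfolding inner_T_def by (simp only: Bochner_Integration.integral_cnj)
qed

lemma fourier_coeff_circle_char: "fourier_coeff (circle_char l) m = (if l = m then 1 else 0)"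
proof -
  have "fourier_coeff (circle_char l) m = (LINT x|lebesgue_on {0..1}. circle_char (l - m) x)"
    by (simp add: fourier_coeff_def inner_T_def cnj_circle_char circle_char_mult)
  also have "\<dots> = (if l = m then 1 else 0)"
  proof (cases "l = m")
    case True
    then show ?thesis by (simp add: measure_restrict_space)
  next
    case False
    define w where "w = 2 * pi * of_int (l - m)"
    have w: "w \<noteq> 0" using False by (simp add: w_def)
    have cc: "circle_char (l - m) x = cis (w * x)" for x by (simp add: circle_char_def w_def)
    have "((\<lambda>x. cis (w * x)) has_integral (cis (w * 1) / (\<i> * w) - cis (w * 0) / (\<i> * w))) {0..1}"
    proof (rule fundamental_theorem_of_calculus)
      fix x :: real
      have "((\<lambda>x. cis (w * x)) has_vector_derivative w *\<^sub>R (\<i> * cis (w * x))) (at x within {0..1})"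
      proof -
        have "((\<lambda>x. exp (of_real x * (\<i> * of_real w))) has_vector_derivative
             exp (of_real x * (\<i> * of_real w)) * (\<i> * of_real w)) (at x within {0..1})"
          by (rule exp_scaleR_has_vector_derivative_right[of "\<i> * of_real w", unfolded scaleR_conv_of_real])
        then show ?thesis
          by (simp add: cis_conv_exp scaleR_conv_of_real mult_ac)
      qed
      from has_vector_derivative_divide[OF this, of "\<i> * w"]
      show "((\<lambda>x. cis (w * x) / (\<i> * w)) has_vector_derivative cis (w * x)) (at x within {0..1})"
        using w by (simp add: scaleR_conv_of_real)
    qed simp
    moreover have "cis w = 1" unfolding w_def by (rule cis_multiple_2pi) simp
    ultimately have "integral {0..1} (circle_char (l - m)) = 0"
      unfolding cc[abs_def] by (simp add: integral_unique)
    moreover have "integrable (lebesgue_on {0..1}) (circle_char (l - m))"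
      by (rule unit_interval.integrable_const_bound[where B = 1]) auto
    ultimately show ?thesis using False by (simp add: lebesgue_integral_eq_integral)
  qed
  finally show ?thesis .
qed

lemma fourier_coeff_add:
  assumes "L2_unit f" "L2_unit g"
  shows "fourier_coeff (\<lambda>x. f x + g x) l = fourier_coeff f l + fourier_coeff g l"
  unfolding fourier_coeff_def inner_T_def distrib_right
  by (intro Bochner_Integration.integral_add square_integrable_mult assms square_integrable_circle_char)

lemma fourier_coeff_cmult:
  "fourier_coeff (\<lambda>x. a * f x) l = a * fourier_coeff f l"
  by (simp add: fourier_coeff_def inner_T_def mult.assoc)

text \<open>Stated for integrable \<open>G\<close>, because it is applied to a function whose square
  integrability is still to be proved.\<close>

lemma inner_T_trig_sum:
  assumes "finite F" and G: "integrable (lebesgue_on {0..1}) G"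
  shows "inner_T G (\<lambda>x. \<Sum>l\<in>F. a l * circle_char l x) = (\<Sum>l\<in>F. fourier_coeff G l * cnj (a l))"
proof -
  have int: "integrable (lebesgue_on {0..1}) (\<lambda>x. G x * cnj (circle_char l x))" for l
  proof (rule Bochner_Integration.integrable_bound[OF G])
    have [measurable]: "G \<in> borel_measurable (lebesgue_on {0..1})" using G by auto
    show "(\<lambda>x. G x * cnj (circle_char l x)) \<in> borel_measurable (lebesgue_on {0..1})" by measurable
  qed (simp add: norm_mult)
  have "inner_T G (\<lambda>x. \<Sum>l\<in>F. a l * circle_char l x)
     = (LINT x|lebesgue_on {0..1}. (\<Sum>l\<in>F. cnj (a l) * (G x * cnj (circle_char l x))))"
    unfolding inner_T_def by (simp add: sum_distrib_left mult_ac)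
  also have "\<dots> = (\<Sum>l\<in>F. cnj (a l) * fourier_coeff G l)"
    unfolding fourier_coeff_def inner_T_def
    by (subst Bochner_Integration.integral_sum) (auto intro: int)
  finally show ?thesis by (simp add: mult.commute)
qed

lemma fourier_coeff_trig_sum:
  assumes "finite F"
  shows "fourier_coeff (\<lambda>x. \<Sum>l\<in>F. a l * circle_char l x) m = (if m \<in> F then a m else 0)"
proof -
  have "integrable (lebesgue_on {0..1}) (circle_char m)"
    by (rule unit_interval.integrable_const_bound[where B = 1]) auto
  from inner_T_trig_sum[OF assms this, of a]
  have "fourier_coeff (\<lambda>x. \<Sum>l\<in>F. a l * circle_char l x) m = cnj (\<Sum>l\<in>F. (if m = l then 1 else 0) * cnj (a l))"
    unfolding fourier_coeff_def[of "\<lambda>x. \<Sum>l\<in>F. a l * circle_char l x"] fourier_coeff_circle_char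
    by (subst inner_T_commute) simp
  also have "(\<Sum>l\<in>F. (if m = l then 1 else 0) * cnj (a l)) = (\<Sum>l\<in>F. if m = l then cnj (a l) else 0)"
    by (intro sum.cong) auto
  finally show ?thesis using assms by (simp add: sum.delta)
qed

lemma norm_trig_sum:
  assumes "finite F"
  shows "(LINT x|lebesgue_on {0..1}. (cmod (\<Sum>l\<in>F. a l * circle_char l x))\<^sup>2) = (\<Sum>l\<in>F. (cmod (a l))\<^sup>2)"
proof -
  let ?p = "\<lambda>x. \<Sum>l\<in>F. a l * circle_char l x"
  have "trig_poly ?p" using assms by (auto simp: trig_poly_def)
  then have "L2_unit ?p" by (rule square_integrable_trig_poly)
  from square_integrable_mult[OF this square_integrable_circle_char[of 0]]
  have "integrable (lebesgue_on {0..1}) ?p" by simp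
  from inner_T_trig_sum[OF assms this, of a]
  have "complex_of_real (LINT x|lebesgue_on {0..1}. (cmod (?p x))\<^sup>2) = (\<Sum>l\<in>F. a l * cnj (a l))"
    unfolding inner_T_self using assms by (simp add: fourier_coeff_trig_sum)
  also have "\<dots> = complex_of_real (\<Sum>l\<in>F. (cmod (a l))\<^sup>2)"
    by (simp add: complex_norm_square del: of_real_power)
  finally show ?thesis using of_real_eq_iff by blast
qed

text \<open>Completing the square in the coefficients. The choice \<open>a = fourier_coeff f\<close>
  gives the Bessel inequality; discarding the last sum shows that no other choice of
  \<open>a\<close> comes closer to \<open>f\<close>.\<close>

lemma norm_diff_trig_sum:
  assumes F: "finite F" and f: "L2_unit f"
  shows "(LINT x|lebesgue_on {0..1}. (cmod (f x - (\<Sum>l\<in>F. a l * circle_char l x)))\<^sup>2)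
     = (LINT x|lebesgue_on {0..1}. (cmod (f x))\<^sup>2) - (\<Sum>l\<in>F. (cmod (fourier_coeff f l))\<^sup>2)
       + (\<Sum>l\<in>F. (cmod (fourier_coeff f l - a l))\<^sup>2)"
proof -
  let ?p = "\<lambda>x. \<Sum>l\<in>F. a l * circle_char l x"
  have p: "L2_unit ?p" by (rule square_integrable_trig_poly) (use F in \<open>auto simp: trig_poly_def\<close>)
  have fi: "integrable (lebesgue_on {0..1}) f"
    using square_integrable_mult[OF f square_integrable_circle_char[of 0]] by simp
  have expand: "(cmod (x - y))\<^sup>2 = (cmod x)\<^sup>2 + (cmod y)\<^sup>2 - 2 * Re (x * cnj y)" for x y
    unfolding cmod_power2 by (simp add: power2_eq_square algebra_simps)
  have i: "integrable (lebesgue_on {0..1}) (\<lambda>x. (cmod (f x))\<^sup>2)"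
    "integrable (lebesgue_on {0..1}) (\<lambda>x. (cmod (?p x))\<^sup>2)"
    using f p by (simp_all add: square_integrable_def)
  have ip: "integrable (lebesgue_on {0..1}) (\<lambda>x. f x * cnj (?p x))"
    by (rule square_integrable_mult[OF f p])
  have "(LINT x|lebesgue_on {0..1}. (cmod (f x - ?p x))\<^sup>2)
    = (LINT x|lebesgue_on {0..1}. (cmod (f x))\<^sup>2) + (LINT x|lebesgue_on {0..1}. (cmod (?p x))\<^sup>2) - 2 * Re (inner_T f ?p)"
    unfolding expand inner_T_def integral_Re[OF ip, symmetric]
    using i integrable_Re[OF ip] by (simp del: Re_sum complex_cnj_mult cnj_sum times_complex.sel)
  also have "\<dots> = (LINT x|lebesgue_on {0..1}. (cmod (f x))\<^sup>2)
      + (\<Sum>l\<in>F. (cmod (a l))\<^sup>2 - 2 * Re (fourier_coeff f l * cnj (a l)))"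
    unfolding inner_T_trig_sum[OF F fi] norm_trig_sum[OF F] Re_sum
    by (simp add: sum_subtractf sum_distrib_left)
  also have "(\<Sum>l\<in>F. (cmod (a l))\<^sup>2 - 2 * Re (fourier_coeff f l * cnj (a l)))
     = (\<Sum>l\<in>F. (cmod (fourier_coeff f l - a l))\<^sup>2 - (cmod (fourier_coeff f l))\<^sup>2)"
    by (intro sum.cong refl) (simp only: expand)
  finally show ?thesis by (simp add: sum_subtractf)
qed

section \<open>Density in mean square and the Parseval identity\<close>

lemma trig_poly_L2_dense_bounded:
  assumes h: "h \<in> borel_measurable (lebesgue_on {0..1})" and B: "\<And>x. cmod (h x) \<le> B"
    and e: "0 < e"
  shows "\<exists>p. trig_poly p \<and> (LINT x|lebesgue_on {0..1}. (cmod (h x - p x))\<^sup>2) < e"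
proof -
  obtain p where p: "\<And>n::nat. trig_poly (p n)" "\<And>n x. cmod (p n x) \<le> B + 1"
    and lim: "AE x in lebesgue_on {0..1}. (\<lambda>n. p n x) \<longlonglongrightarrow> h x"
    using bounded_measurable_trig_poly_approx[OF h B] by metis
  have [measurable]: "h \<in> borel_measurable (lebesgue_on {0..1})" by fact
  have [measurable]: "p n \<in> borel_measurable (lebesgue_on {0..1})" for n
    by (rule square_integrable_measurable[OF square_integrable_trig_poly[OF p(1)]])
  have "(\<lambda>n. LINT x|lebesgue_on {0..1}. (cmod (h x - p n x))\<^sup>2) \<longlonglongrightarrow> (LINT x|lebesgue_on {0..1::real}. 0)"
  \<comment> \<open>The constant is \<open>B\<close> for \<open>h\<close> plus \<open>B + 1\<close>
    for the approximants.\<close>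
  proof (rule integral_dominated_convergence[where w = "\<lambda>x. (2 * B + 1)\<^sup>2"])
    show "AE x in lebesgue_on {0..1}. (\<lambda>n. (cmod (h x - p n x))\<^sup>2) \<longlonglongrightarrow> 0"
      using lim
    proof eventually_elim
      case (elim x)
      have "(\<lambda>n. (cmod (h x - p n x))\<^sup>2) \<longlonglongrightarrow> (cmod (h x - h x))\<^sup>2"
        by (intro tendsto_power tendsto_norm tendsto_diff tendsto_const elim)
      then show ?case by simp
    qed
    have "(cmod (h x - p n x))\<^sup>2 \<le> (2 * B + 1)\<^sup>2" for n x
    proof (rule power_mono)
      show "cmod (h x - p n x) \<le> 2 * B + 1"
        using norm_triangle_ineq4[of "h x" "p n x"] B[of x] p(2)[of n x] by linarith
    qed simp
    then show "AE x in lebesgue_on {0..1}. norm ((cmod (h x - p n x))\<^sup>2) \<le> (2 * B + 1)\<^sup>2" for n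
      by (intro AE_I2) simp
  qed simp_all
  then have "(\<lambda>n. LINT x|lebesgue_on {0..1}. (cmod (h x - p n x))\<^sup>2) \<longlonglongrightarrow> 0" by simp
  from order_tendstoD(2)[OF this e] obtain n where "(LINT x|lebesgue_on {0..1}. (cmod (h x - p n x))\<^sup>2) < e"
    by (auto dest: eventually_happens)
  with p(1) show ?thesis by blast
qed

lemma square_integrable_truncation_lim:
  assumes f: "square_integrable M f"
  shows "(\<lambda>n. LINT x|M. (cmod (f x - (if cmod (f x) \<le> real n then f x else 0)))\<^sup>2) \<longlonglongrightarrow> 0"
proof -
  have [measurable]: "f \<in> borel_measurable M" using f by (rule square_integrable_measurable)
  have "(\<lambda>n. LINT x|M. (cmod (f x - (if cmod (f x) \<le> real n then f x else 0)))\<^sup>2) \<longlonglongrightarrow> (LINT x|M. 0)"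
  proof (rule integral_dominated_convergence[where w = "\<lambda>x. (cmod (f x))\<^sup>2"])
    show "AE x in M. (\<lambda>n. (cmod (f x - (if cmod (f x) \<le> real n then f x else 0)))\<^sup>2) \<longlonglongrightarrow> 0"
    proof (rule AE_I2, rule tendsto_eventually)
      fix x
      obtain m :: nat where "cmod (f x) \<le> real m" using real_arch_simple by blast
      then have "\<forall>n\<ge>m. (cmod (f x - (if cmod (f x) \<le> real n then f x else 0)))\<^sup>2 = 0" by auto
      then show "\<forall>\<^sub>F n in sequentially. (cmod (f x - (if cmod (f x) \<le> real n then f x else 0)))\<^sup>2 = 0"
        unfolding eventually_sequentially by blast
    qed
    show "integrable M (\<lambda>x. (cmod (f x))\<^sup>2)" using f by (simp add: square_integrable_def)
  qed (simp_all, measurable)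
  then show ?thesis by simp
qed

lemma trig_poly_L2_dense:
  assumes f: "L2_unit f" and e: "0 < e"
  shows "\<exists>p. trig_poly p \<and> (LINT x|lebesgue_on {0..1}. (cmod (f x - p x))\<^sup>2) < e"
proof -
  let ?h = "\<lambda>n x. if cmod (f x) \<le> real n then f x else 0"
  have [measurable]: "f \<in> borel_measurable (lebesgue_on {0..1})" using f by (rule square_integrable_measurable)
  \<comment> \<open>The squared triangle inequality doubles each of the two errors, from truncating
    and from approximating, so each may cost \<open>e / 4\<close>.\<close>
  have "0 < e / 4" using e by simp
  from order_tendstoD(2)[OF square_integrable_truncation_lim[OF f] this]
  obtain n where n: "(LINT x|lebesgue_on {0..1}. (cmod (f x - ?h n x))\<^sup>2) < e / 4"
    by (auto dest: eventually_happens)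
  have hm: "?h n \<in> borel_measurable (lebesgue_on {0..1})" by measurable
  have hb: "cmod (?h n x) \<le> real n" for x by simp
  from trig_poly_L2_dense_bounded[OF hm hb \<open>0 < e / 4\<close>]
  obtain p where p: "trig_poly p" "(LINT x|lebesgue_on {0..1}. (cmod (?h n x - p x))\<^sup>2) < e / 4" by blast
  have L2: "L2_unit (?h n)" by (rule unit_interval.bounded_square_integrable[OF hm hb])
  have L2p: "L2_unit p" by (rule square_integrable_trig_poly[OF p(1)])
  have i1: "integrable (lebesgue_on {0..1}) (\<lambda>x. (cmod (f x - ?h n x))\<^sup>2)"
    and i2: "integrable (lebesgue_on {0..1}) (\<lambda>x. (cmod (?h n x - p x))\<^sup>2)"
    and i3: "integrable (lebesgue_on {0..1}) (\<lambda>x. (cmod (f x - p x))\<^sup>2)"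
    using square_integrable_diff[OF f L2] square_integrable_diff[OF L2 L2p] square_integrable_diff[OF f L2p]
    unfolding square_integrable_def by blast+
  have "(LINT x|lebesgue_on {0..1}. (cmod (f x - p x))\<^sup>2)
     \<le> (LINT x|lebesgue_on {0..1}. 2 * (cmod (f x - ?h n x))\<^sup>2 + 2 * (cmod (?h n x - p x))\<^sup>2)"
  proof (rule integral_mono[OF i3])
    show "integrable (lebesgue_on {0..1}) (\<lambda>x. 2 * (cmod (f x - ?h n x))\<^sup>2 + 2 * (cmod (?h n x - p x))\<^sup>2)"
      by (rule Bochner_Integration.integrable_add[OF integrable_mult_right[OF i1] integrable_mult_right[OF i2]])
    show "(cmod (f x - p x))\<^sup>2 \<le> 2 * (cmod (f x - ?h n x))\<^sup>2 + 2 * (cmod (?h n x - p x))\<^sup>2" for x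
      using cmod_add_power2_le[of "f x - ?h n x" "?h n x - p x"] by (simp only: diff_add_cancel add_diff_eq)
  qed
  also have "\<dots> = 2 * (LINT x|lebesgue_on {0..1}. (cmod (f x - ?h n x))\<^sup>2)
      + 2 * (LINT x|lebesgue_on {0..1}. (cmod (?h n x - p x))\<^sup>2)"
    by (subst Bochner_Integration.integral_add[OF integrable_mult_right[OF i1] integrable_mult_right[OF i2]])
       (simp only: integral_mult_right_zero)
  also have "\<dots> < e" using n p(2) by linarith
  finally show ?thesis using p(1) by blast
qed

lemma Bessel_inequality:
  assumes "finite F" "L2_unit f"
  shows "(\<Sum>l\<in>F. (cmod (fourier_coeff f l))\<^sup>2) \<le> (LINT x|lebesgue_on {0..1}. (cmod (f x))\<^sup>2)"
proof -
  have "0 \<le> (LINT x|lebesgue_on {0..1}. (cmod (f x - (\<Sum>l\<in>F. fourier_coeff f l * circle_char l x)))\<^sup>2)"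
    by (rule integral_nonneg_AE) simp
  then show ?thesis unfolding norm_diff_trig_sum[OF assms] by simp
qed

text \<open>The Bessel inequality gives one direction. For the other, a trigonometric polynomial
  close to \<open>f\<close> shows that the partial sum over its frequencies already misses less than
  \<open>e\<close> of the squared norm.\<close>

lemma Parseval_fourier_coeff:
  assumes f: "L2_unit f"
  shows "((\<lambda>l. (cmod (fourier_coeff f l))\<^sup>2) has_sum (LINT x|lebesgue_on {0..1}. (cmod (f x))\<^sup>2)) UNIV"
    (is "(?c has_sum ?T) UNIV")
proof -
  have s: "?c summable_on UNIV" and le: "infsum ?c UNIV \<le> ?T"
    using bounded_finite_sums_imp_summable_on[of UNIV ?c ?T] Bessel_inequality[OF _ f] by auto
  have "?T \<le> infsum ?c UNIV + e" if e: "0 < e" for e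
  proof -
    obtain p where "trig_poly p" and less: "(LINT x|lebesgue_on {0..1}. (cmod (f x - p x))\<^sup>2) < e"
      using trig_poly_L2_dense[OF f e] by blast
    then obtain F a where F: "finite F" "p = (\<lambda>x. \<Sum>l\<in>F. a l * circle_char l x)"
      by (auto simp: trig_poly_def)
    have "?T - sum ?c F \<le> (LINT x|lebesgue_on {0..1}. (cmod (f x - p x))\<^sup>2)"
      unfolding F(2) norm_diff_trig_sum[OF F(1) f] by (simp add: sum_nonneg)
    moreover have "sum ?c F \<le> infsum ?c UNIV"
      by (rule finite_sum_le_infsum[OF s F(1)]) auto
    ultimately show ?thesis using less by linarith
  qed
  then have "?T \<le> infsum ?c UNIV" by (rule field_le_epsilon)
  with le s show ?thesis by (simp add: has_sum_iff)
qed

text \<open>The first square supplies the real part and the second the imaginary part of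
  \<open>a * cnj b\<close>, so two squares besides those of \<open>a\<close> and \<open>b\<close>
  suffice.\<close>

lemma polarization:
  fixes a b :: complex
  shows "2 * (a * cnj b) = of_real ((cmod (a + b))\<^sup>2) + \<i> * of_real ((cmod (a + \<i> * b))\<^sup>2)
      + (- 1 - \<i>) * (of_real ((cmod a)\<^sup>2) + of_real ((cmod b)\<^sup>2))"
  unfolding cmod_power2 by (simp add: complex_eq_iff power2_eq_square algebra_simps)

text \<open>The same polarization identity is used twice, pointwise under the integral and termwise
  in the coefficients, which reduces the claim to squared norms of four functions.\<close>

lemma Parseval_fourier_coeff_inner:
  assumes f: "L2_unit f" and g: "L2_unit g"
  shows "((\<lambda>l. fourier_coeff f l * cnj (fourier_coeff g l)) has_sum inner_T f g) UNIV"
proof -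
  let ?I = "\<lambda>f. complex_of_real (LINT x|lebesgue_on {0..1}. (cmod (f x))\<^sup>2)"
  let ?c = "\<lambda>f l. complex_of_real ((cmod (fourier_coeff f l))\<^sup>2)"
  let ?s = "\<lambda>x. f x + g x" and ?t = "\<lambda>x. f x + \<i> * g x"
  have ig: "L2_unit (\<lambda>x. \<i> * g x)" by (rule square_integrable_cmult[OF g])
  have s: "L2_unit ?s" by (rule square_integrable_add[OF f g])
  have t: "L2_unit ?t" by (rule square_integrable_add[OF f ig])
  have P: "(?c u has_sum ?I u) UNIV" if "L2_unit u" for u
    by (rule has_sum_of_real[OF Parseval_fourier_coeff[OF that]])
  have int: "integrable (lebesgue_on {0..1}) (\<lambda>x. complex_of_real ((cmod (u x))\<^sup>2))" if "L2_unit u" for u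
    using that by (simp add: square_integrable_def del: of_real_power)
  have "2 * inner_T f g = (LINT x|lebesgue_on {0..1}. 2 * (f x * cnj (g x)))"
    unfolding inner_T_def by simp
  also have "\<dots> = ?I ?s + \<i> * ?I ?t + (- 1 - \<i>) * (?I f + ?I g)"
    unfolding polarization integral_complex_of_real[symmetric]
    using int[OF s] int[OF t] int[OF f] int[OF g]
    by (subst Bochner_Integration.integral_add;
        (simp del: of_real_power integral_complex_of_real)?)+
  finally have I: "2 * inner_T f g = ?I ?s + \<i> * ?I ?t + (- 1 - \<i>) * (?I f + ?I g)" .
  have "((\<lambda>l. ?c ?s l + \<i> * ?c ?t l + (- 1 - \<i>) * (?c f l + ?c g l)) has_sum
        (?I ?s + \<i> * ?I ?t + (- 1 - \<i>) * (?I f + ?I g))) UNIV"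
    by (intro has_sum_add has_sum_cmult_right P f g s t)
  moreover have "?c ?s l + \<i> * ?c ?t l + (- 1 - \<i>) * (?c f l + ?c g l)
      = 2 * (fourier_coeff f l * cnj (fourier_coeff g l))" for l
    unfolding polarization fourier_coeff_add[OF f g] fourier_coeff_add[OF f ig] fourier_coeff_cmult ..
  ultimately have "((\<lambda>l. 2 * (fourier_coeff f l * cnj (fourier_coeff g l))) has_sum 2 * inner_T f g) UNIV"
    unfolding I by simp
  from has_sum_cmult_right[OF this, of "1 / 2"] show ?thesis by simp
qed

text \<open>By duality: pairing \<open>G\<close> with trigonometric polynomials that approximate its truncations \<open>h n\<close>
  bounds the square norms of the \<open>h n\<close> uniformly.\<close>

lemma square_summable_fourier_coeff_imp_square_integrable:
  assumes G: "integrable (lebesgue_on {0..1}) G"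
    and c: "(\<lambda>l. (cmod (fourier_coeff G l))\<^sup>2) summable_on UNIV"
  shows "L2_unit G"
proof -
  let ?M = "lebesgue_on {0..1::real}"
  define C where "C = (\<Sum>\<^sub>\<infinity>l. (cmod (fourier_coeff G l))\<^sup>2)"
  have [measurable]: "G \<in> borel_measurable ?M" using G by auto
  define h where "h n x = (if cmod (G x) \<le> real n then G x else 0)" for n x
  have hm [measurable]: "h n \<in> borel_measurable ?M" for n unfolding h_def by measurable
  have hb: "cmod (h n x) \<le> real n" for n x by (simp add: h_def)
  have hL2: "L2_unit (h n)" for n by (rule unit_interval.bounded_square_integrable[OF hm hb])
  \<comment> \<open>Against a trigonometric polynomial the pairing with \<open>G\<close> is a finite
    sum of coefficients, so Cauchy-Schwarz needs only that the coefficients of \<open>G\<close> are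
    square-summable.\<close>
  have poly: "(cmod (inner_T G p))\<^sup>2 \<le> C * (LINT x|?M. (cmod (p x))\<^sup>2)" if p: "trig_poly p" for p
  proof -
    obtain F a where F: "finite F" "p = (\<lambda>x. \<Sum>l\<in>F. a l * circle_char l x)"
      using p by (auto simp: trig_poly_def)
    have "cmod (inner_T G p) \<le> (\<Sum>l\<in>F. cmod (fourier_coeff G l) * cmod (a l))"
      unfolding F(2) inner_T_trig_sum[OF F(1) G] by (rule sum_norm_le) (simp add: norm_mult)
    then have "(cmod (inner_T G p))\<^sup>2 \<le> (\<Sum>l\<in>F. cmod (fourier_coeff G l) * cmod (a l))\<^sup>2"
      by (intro power_mono) auto
    also have "\<dots> \<le> (\<Sum>l\<in>F. (cmod (fourier_coeff G l))\<^sup>2) * (\<Sum>l\<in>F. (cmod (a l))\<^sup>2)"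
      by (rule Cauchy_Schwarz_ineq_sum)
    also have "\<dots> \<le> C * (\<Sum>l\<in>F. (cmod (a l))\<^sup>2)"
      unfolding C_def by (intro mult_right_mono finite_sum_le_infsum c F(1) sum_nonneg) auto
    also have "(\<Sum>l\<in>F. (cmod (a l))\<^sup>2) = (LINT x|?M. (cmod (p x))\<^sup>2)"
      unfolding F(2) by (rule norm_trig_sum[OF F(1), symmetric])
    finally show ?thesis .
  qed
  have bound: "(LINT x|?M. (cmod (h n x))\<^sup>2) \<le> C" for n
  proof -
    let ?X = "LINT x|?M. (cmod (h n x))\<^sup>2"
    obtain p where p: "\<And>k::nat. trig_poly (p k)" "\<And>k x. cmod (p k x) \<le> real n + 1"
      and lim: "AE x in ?M. (\<lambda>k. p k x) \<longlonglongrightarrow> h n x"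
      using bounded_measurable_trig_poly_approx[OF hm hb] by metis
    have [measurable]: "p k \<in> borel_measurable ?M" for k
      by (rule square_integrable_measurable[OF square_integrable_trig_poly[OF p(1)]])
    \<comment> \<open>The approximants are bounded uniformly in \<open>k\<close>, so a multiple of
      the integrable function \<open>cmod (G x)\<close> dominates.\<close>
    have "(\<lambda>k. LINT x|?M. G x * cnj (p k x)) \<longlonglongrightarrow> (LINT x|?M. G x * cnj (h n x))"
    proof (rule integral_dominated_convergence[where w = "\<lambda>x. cmod (G x) * (real n + 1)"])
      show "AE x in ?M. (\<lambda>k. G x * cnj (p k x)) \<longlonglongrightarrow> G x * cnj (h n x)"
        using lim by eventually_elim (intro tendsto_intros)
      show "AE x in ?M. norm (G x * cnj (p k x)) \<le> cmod (G x) * (real n + 1)" for k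
        using p(2) by (intro AE_I2) (simp add: norm_mult mult_left_mono)
      show "integrable ?M (\<lambda>x. cmod (G x) * (real n + 1))" using G by simp
    qed measurable
    \<comment> \<open>\<open>G\<close> agrees with \<open>h n\<close> wherever the latter is
      nonzero, so the pairing is the squared norm of the truncation.\<close>
    moreover have "(LINT x|?M. G x * cnj (h n x)) = inner_T (h n) (h n)"
      unfolding inner_T_def by (intro Bochner_Integration.integral_cong) (auto simp: h_def)
    ultimately have 1: "(\<lambda>k. inner_T G (p k)) \<longlonglongrightarrow> of_real ?X"
      unfolding inner_T_self by (simp only: inner_T_def)
    have 2: "(\<lambda>k. LINT x|?M. (cmod (p k x))\<^sup>2) \<longlonglongrightarrow> ?X"
    proof (rule integral_dominated_convergence[where w = "\<lambda>x. (real n + 1)\<^sup>2"])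
      show "AE x in ?M. (\<lambda>k. (cmod (p k x))\<^sup>2) \<longlonglongrightarrow> (cmod (h n x))\<^sup>2"
        using lim by eventually_elim (intro tendsto_intros)
      show "AE x in ?M. norm ((cmod (p k x))\<^sup>2) \<le> (real n + 1)\<^sup>2" for k
        using p(2) by (intro AE_I2) (simp add: power_mono)
      show "integrable ?M (\<lambda>x. (real n + 1)\<^sup>2)" by simp
    qed measurable
    have "(cmod (of_real ?X))\<^sup>2 \<le> C * ?X"
    proof (rule LIMSEQ_le)
      show "(\<lambda>k. (cmod (inner_T G (p k)))\<^sup>2) \<longlonglongrightarrow> (cmod (of_real ?X))\<^sup>2"
        by (intro tendsto_power tendsto_norm 1)
      show "(\<lambda>k. C * (LINT x|?M. (cmod (p k x))\<^sup>2)) \<longlonglongrightarrow> C * ?X"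
        by (intro tendsto_mult tendsto_const 2)
    qed (use poly p(1) in blast)
    \<comment> \<open>The squared norm occurs squared on the left and once on the right; cancelling
      it leaves a bound free of \<open>n\<close>.\<close>
    then have "?X * ?X \<le> C * ?X" by (simp add: power2_eq_square)
    moreover have "?X \<ge> 0" by (rule integral_nonneg_AE) simp
    moreover have "C \<ge> 0" unfolding C_def by (intro infsum_nonneg) simp
    ultimately show ?thesis by (cases "?X = 0") (auto simp: mult_le_cancel_right)
  qed
  have "integrable ?M (\<lambda>x. (cmod (G x))\<^sup>2)"
  proof (rule integrable_monotone_convergence[where f = "\<lambda>n x. (cmod (h n x))\<^sup>2"])
    show "integrable ?M (\<lambda>x. (cmod (h n x))\<^sup>2)" for n using hL2 by (simp add: square_integrable_def)
    have inc: "incseq (\<lambda>n. (cmod (h n x))\<^sup>2)" for x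
      by (rule incseq_SucI) (auto simp: h_def)
    then show "AE x in ?M. mono (\<lambda>n. (cmod (h n x))\<^sup>2)" by (intro AE_I2)
    show "AE x in ?M. (\<lambda>n. (cmod (h n x))\<^sup>2) \<longlonglongrightarrow> (cmod (G x))\<^sup>2"
    proof (rule AE_I2, rule tendsto_eventually)
      fix x
      obtain m :: nat where "cmod (G x) \<le> real m" using real_arch_simple by blast
      then have "\<forall>n\<ge>m. (cmod (h n x))\<^sup>2 = (cmod (G x))\<^sup>2" by (auto simp: h_def)
      then show "\<forall>\<^sub>F n in sequentially. (cmod (h n x))\<^sup>2 = (cmod (G x))\<^sup>2"
        unfolding eventually_sequentially by blast
    qed
    have "mono (\<lambda>n. LINT x|?M. (cmod (h n x))\<^sup>2)"
    proof (rule monoI)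
      fix m n :: nat assume "m \<le> n"
      then show "(LINT x|?M. (cmod (h m x))\<^sup>2) \<le> (LINT x|?M. (cmod (h n x))\<^sup>2)"
        using hL2 inc by (intro integral_mono) (auto simp: square_integrable_def mono_def)
    qed
    from bound this
    show "(\<lambda>n. LINT x|?M. (cmod (h n x))\<^sup>2) \<longlonglongrightarrow> (SUP n. LINT x|?M. (cmod (h n x))\<^sup>2)"
      by (intro LIMSEQ_incseq_SUP bdd_aboveI2[of _ _ C]) auto
  qed measurable
  then show ?thesis by (simp add: square_integrable_def)
qed

section \<open>Periodization\<close>

lemma measurable_lebesgue_translate:
  fixes g :: "real \<Rightarrow> 'a::topological_space"
  assumes "g \<in> borel_measurable lebesgue"
  shows "(\<lambda>x. g (x - t)) \<in> borel_measurable lebesgue"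
proof -
  have "(\<lambda>x. - t + 1 * x) \<in> lebesgue \<rightarrow>\<^sub>M lebesgue"
    using lebesgue_affine_measurable[where c = "\<lambda>x::real. 1" and t = "- t"] by simp
  from measurable_compose[OF this assms] show ?thesis by simp
qed

text \<open>With \<open>m = int_decode n\<close>, the interval from \<open>- m\<close> to
  \<open>1 - m\<close> is the image of \<open>[0, 1)\<close> under \<open>x - m\<close>. Enumerating
  the integers by naturals makes the theorems on series of integrals applicable; half-open intervals
  make the tiling exact.\<close>

lemma UN_unit_intervals: "(\<Union>n. {- of_int (int_decode n)..<1 - of_int (int_decode n)}) = (UNIV :: real set)"
proof -
  have "x \<in> {- of_int (int_decode n)..<1 - of_int (int_decode n)}" if "n = int_encode (- \<lfloor>x\<rfloor>)" for x :: real and n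
    using that by (simp) linarith
  then show ?thesis by blast
qed

lemma disjoint_family_unit_intervals:
  "disjoint_family (\<lambda>n. {- of_int (int_decode n)..<1 - of_int (int_decode n) :: real})"
proof -
  have "n = m" if "x \<in> {- of_int (int_decode n)..<1 - of_int (int_decode n)}"
    "x \<in> {- of_int (int_decode m)..<1 - of_int (int_decode m)}" for n m and x :: real
  proof -
    have "int_decode n = - \<lfloor>x\<rfloor>" "int_decode m = - \<lfloor>x\<rfloor>" using that by (auto, linarith+)
    then show ?thesis by (metis int_decode_inverse)
  qed
  then show ?thesis unfolding disjoint_family_on_def by blast
qed

text \<open>The bridge between the half-open tiles and the closed interval over which
  \<open>inner_T\<close> integrates.\<close>

lemma AE_indicator_unit_interval:
  "AE x in lebesgue. indicator {0..<1} x = (indicator {0..1} (x::real) :: 'a::zero_neq_one)"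
proof -
  have "{1::real} \<in> null_sets lebesgue" by (simp add: negligible_iff_null_sets[symmetric])
  then have "AE x in lebesgue. x \<notin> {1::real}" by (rule AE_not_in)
  then show ?thesis by eventually_elim (auto simp: indicator_def)
qed

lemma nn_integral_unfold_translates:
  fixes v :: "real \<Rightarrow> ennreal"
  assumes v [measurable]: "v \<in> borel_measurable lebesgue"
  shows "(\<Sum>n. \<integral>\<^sup>+x. v (x - of_int (int_decode n)) \<partial>lebesgue_on {0..1}) = (\<integral>\<^sup>+x. v x \<partial>lebesgue)"
proof -
  let ?I = "\<lambda>n. {- of_int (int_decode n)..<1 - of_int (int_decode n) :: real}"
  have "(\<integral>\<^sup>+x. v (x - of_int (int_decode n)) \<partial>lebesgue_on {0..1}) = (\<integral>\<^sup>+x\<in>?I n. v x \<partial>lebesgue)" for n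
  proof -
    let ?m = "of_int (int_decode n) :: real"
    have "(\<integral>\<^sup>+x\<in>?I n. v x \<partial>lebesgue) = ennreal \<bar>1\<bar> * (\<integral>\<^sup>+x. v (- ?m + 1 * x) * indicator (?I n) (- ?m + 1 * x) \<partial>lebesgue)"
      by (rule nn_integral_real_affine_lebesgue) (auto intro!: borel_measurable_times_ennreal borel_measurable_indicator)
    also have "\<dots> = (\<integral>\<^sup>+x. v (x - ?m) * indicator {0..<1} x \<partial>lebesgue)"
      by (simp, intro nn_integral_cong) (auto simp: indicator_def)
    also have "\<dots> = (\<integral>\<^sup>+x. v (x - ?m) * indicator {0..1} x \<partial>lebesgue)"
      by (rule nn_integral_cong_AE) (use AE_indicator_unit_interval[where 'a = ennreal] in \<open>eventually_elim, simp\<close>)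
    also have "\<dots> = (\<integral>\<^sup>+x. v (x - ?m) \<partial>lebesgue_on {0..1})"
      by (rule nn_integral_restrict_space[symmetric]) simp
    finally show ?thesis ..
  qed
  then have "(\<Sum>n. \<integral>\<^sup>+x. v (x - of_int (int_decode n)) \<partial>lebesgue_on {0..1}) = (\<Sum>n. \<integral>\<^sup>+x\<in>?I n. v x \<partial>lebesgue)"
    by simp
  also have "\<dots> = (\<integral>\<^sup>+x\<in>(\<Union>n. ?I n). v x \<partial>lebesgue)"
    by (rule nn_integral_disjoint_family[symmetric]) (simp_all add: v disjoint_family_unit_intervals)
  finally show ?thesis unfolding UN_unit_intervals by simp
qed

lemma integral_translate_unit_interval:
  fixes u :: "real \<Rightarrow> complex"
  assumes u: "u \<in> borel_measurable lebesgue"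
  shows "(LINT x|lebesgue_on {0..1}. u (x - m)) = (LINT x:{- m..<1 - m}|lebesgue. u x)"
proof -
  have "(LINT x:{- m..<1 - m}|lebesgue. u x) = \<bar>1\<bar> *\<^sub>R (LINT x|lebesgue. indicator {- m..<1 - m} (- m + 1 * x) *\<^sub>R u (- m + 1 * x))"
    unfolding set_lebesgue_integral_def by (rule lebesgue_integral_real_affine) simp
  also have "\<dots> = (LINT x|lebesgue. indicator {0..<1} x *\<^sub>R u (x - m))"
    by (simp, intro Bochner_Integration.integral_cong) (auto simp: indicator_def)
  also have "\<dots> = (LINT x|lebesgue. indicator {0..1} x *\<^sub>R u (x - m))"
  proof (rule integral_cong_AE)
    have [measurable]: "(\<lambda>x. u (x - m)) \<in> borel_measurable lebesgue" by (rule measurable_lebesgue_translate[OF u])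
    have [measurable]: "{0..<1::real} \<in> sets lebesgue" "{0..1::real} \<in> sets lebesgue" by simp_all
    show "(\<lambda>x. indicator {0..<1} x *\<^sub>R u (x - m)) \<in> borel_measurable lebesgue"
      "(\<lambda>x. indicator {0..1} x *\<^sub>R u (x - m)) \<in> borel_measurable lebesgue" by measurable
    show "AE x in lebesgue. indicator {0..<1} x *\<^sub>R u (x - m) = indicator {0..1} x *\<^sub>R u (x - m)"
      using AE_indicator_unit_interval[where 'a = real] by eventually_elim simp
  qed
  also have "\<dots> = (LINT x|lebesgue_on {0..1}. u (x - m))"
    by (rule integral_restrict_space[symmetric]) simp
  finally show ?thesis ..
qed

text \<open>For complex families unordered and absolute summability coincide, so the default value 0
  is taken exactly where the series of moduli is infinite. The explicit case distinction is what
  makes measurability provable.\<close>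

lemma periodize_eq_suminf:
  "periodize g x = (if (\<Sum>n. ennreal (cmod (g (x - of_int (int_decode n))))) \<noteq> top
     then \<Sum>n. g (x - of_int (int_decode n)) else 0)"
proof (cases "(\<Sum>n. ennreal (cmod (g (x - of_int (int_decode n))))) = top")
  case False
  then have s: "summable (\<lambda>n. cmod (g (x - of_int (int_decode n))))"
    by (intro summable_suminf_not_top) auto
  have "((\<lambda>n. g (x - of_int (int_decode n))) has_sum (\<Sum>n. g (x - of_int (int_decode n)))) UNIV"
    by (rule norm_summable_imp_has_sum[OF s]) (use summable_norm_cancel[OF s] in \<open>simp add: summable_sums\<close>)
  then have "((\<lambda>k. g (x - of_int k)) has_sum (\<Sum>n. g (x - of_int (int_decode n)))) UNIV"
    by (subst (asm) has_sum_reindex_bij_betw[OF bij_int_decode, of "\<lambda>k. g (x - of_int k)"])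
  then show ?thesis using False by (simp add: periodize_def infsumI)
next
  case True
  have "\<not> (\<lambda>k. g (x - of_int k)) summable_on UNIV"
  proof
    assume "(\<lambda>k::int. g (x - of_int k)) summable_on UNIV"
    then have "(\<lambda>k::int. cmod (g (x - of_int k))) summable_on UNIV"
      by (simp only: summable_on_iff_abs_summable_on_complex)
    then have "(\<lambda>n. cmod (g (x - of_int (int_decode n)))) summable_on UNIV"
      by (subst summable_on_reindex_bij_betw[OF bij_int_decode, of "\<lambda>k. cmod (g (x - of_int k))"])
    then have "summable (\<lambda>n. cmod (g (x - of_int (int_decode n))))"
      by (rule summable_on_imp_summable)
    then show False using True by (simp add: ennreal_suminf_neq_top)
  qed
  then show ?thesis using True by (simp add: periodize_def infsum_not_exists)
qed

lemma periodize_periodic: "periodize g (x + 1) = periodize g x"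
proof -
  have "bij (\<lambda>n::int. n - 1)" by (rule bij_betw_byWitness[of _ "\<lambda>n. n + 1"]) auto
  from infsum_reindex_bij_betw[OF this, of "\<lambda>n. g (x - of_int n)"]
  show ?thesis by (simp add: periodize_def algebra_simps)
qed

lemma periodize_measurable:
  assumes "g \<in> borel_measurable lebesgue"
  shows "periodize g \<in> borel_measurable lebesgue"
proof -
  have [measurable]: "(\<lambda>x. g (x - t)) \<in> borel_measurable lebesgue" for t
    by (rule measurable_lebesgue_translate[OF assms])
  show ?thesis unfolding periodize_eq_suminf[abs_def] by measurable
qed

text \<open>Tonelli for the moduli shows that their translates have finite total integral over one
  period. This gives absolute convergence almost everywhere and permits exchanging sum and integral,
  after which the tiles reassemble to the line.\<close>

lemma
  assumes u: "integrable lebesgue u"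
  shows integrable_periodize: "integrable (lebesgue_on {0..1}) (periodize u)"
    and integral_periodize: "(LINT x|lebesgue_on {0..1}. periodize u x) = (LINT x|lebesgue. u x)"
proof -
  let ?M = "lebesgue_on {0..1::real}"
  let ?u = "\<lambda>n x. u (x - of_int (int_decode n))"
  have um: "u \<in> borel_measurable lebesgue" using u by auto
  have m [measurable]: "?u n \<in> borel_measurable ?M" for n
    by (rule measurable_restrict_space1[OF measurable_lebesgue_translate[OF um]])
  have "(\<lambda>x. ennreal (cmod (u x))) \<in> borel_measurable lebesgue" using um by measurable
  from nn_integral_unfold_translates[OF this]
  have eq: "(\<Sum>n. \<integral>\<^sup>+x. ennreal (cmod (?u n x)) \<partial>?M) = (\<integral>\<^sup>+x. ennreal (cmod (u x)) \<partial>lebesgue)" .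
  also have fin: "\<dots> < \<infinity>" using u by (simp add: integrable_iff_bounded)
  finally have lt: "(\<Sum>n. \<integral>\<^sup>+x. ennreal (cmod (?u n x)) \<partial>?M) < \<infinity>" .
  have int: "integrable ?M (?u n)" for n
  proof -
    have "(\<integral>\<^sup>+x. ennreal (cmod (?u n x)) \<partial>?M) < \<infinity>"
      using lt ennreal_suminf_lessD by blast
    then show ?thesis using m by (simp add: integrable_iff_bounded)
  qed
  have "(\<integral>\<^sup>+x. (\<Sum>n. ennreal (cmod (?u n x))) \<partial>?M) \<noteq> \<infinity>"
    using lt by (subst nn_integral_suminf) auto
  then have ae: "AE x in ?M. (\<Sum>n. ennreal (cmod (?u n x))) \<noteq> \<infinity>"
    by (intro nn_integral_PInf_AE) auto
  then have ae_sum: "AE x in ?M. summable (\<lambda>n. cmod (?u n x))"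
    by eventually_elim (auto intro: summable_suminf_not_top)
  have "(\<integral>\<^sup>+x. ennreal (cmod (?u n x)) \<partial>?M) = ennreal (LINT x|?M. cmod (?u n x))" for n
    by (rule nn_integral_eq_integral) (use int in auto)
  then have "(\<Sum>n. ennreal (LINT x|?M. cmod (?u n x))) \<noteq> top" using lt by simp
  then have int_sum: "summable (\<lambda>n. LINT x|?M. cmod (?u n x))"
    by (intro summable_suminf_not_top) auto
  have per: "AE x in ?M. (\<Sum>n. ?u n x) = periodize u x"
    using ae by eventually_elim (simp add: periodize_eq_suminf)
  have pm: "periodize u \<in> borel_measurable ?M"
    by (rule measurable_restrict_space1[OF periodize_measurable[OF um]])
  have sm: "(\<lambda>x. \<Sum>n. ?u n x) \<in> borel_measurable ?M" by measurable
  show "integrable ?M (periodize u)"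
    using integrable_suminf[OF int ae_sum int_sum] by (subst (asm) integrable_cong_AE[OF sm pm per])
  have "(LINT x|?M. periodize u x) = (LINT x|?M. (\<Sum>n. ?u n x))"
    by (rule integral_cong_AE[OF pm sm]) (use per in \<open>eventually_elim, simp\<close>)
  also have "\<dots> = (\<Sum>n. LINT x|?M. ?u n x)"
    by (rule integral_suminf[OF int ae_sum int_sum])
  also have "\<dots> = (\<Sum>n. LINT x:{- of_int (int_decode n)..<1 - of_int (int_decode n)}|lebesgue. u x)"
    by (simp only: integral_translate_unit_interval[OF um])
  also have "\<dots> = (LINT x:(\<Union>n. {- of_int (int_decode n)..<1 - of_int (int_decode n)})|lebesgue. u x)"
    by (rule lebesgue_integral_countable_add[symmetric])
       (use disjoint_family_unit_intervals u in \<open>auto simp: disjoint_family_on_def UN_unit_intervals set_integrable_def\<close>)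
  also have "\<dots> = (LINT x|lebesgue. u x)"
    unfolding UN_unit_intervals by (simp add: set_lebesgue_integral_def)
  finally show "(LINT x|?M. periodize u x) = (LINT x|lebesgue. u x)" .
qed

section \<open>Fourier coefficients of periodizations and dyadic shifts\<close>

lemma fourier_coeff_periodize:
  assumes g: "integrable lebesgue g"
  shows "fourier_coeff (periodize g) l = fourier g (of_int l)"
proof -
  let ?e = "\<lambda>x. cis (- 2 * pi * of_int l * x)"
  have e_cnj: "cnj (circle_char l x) = ?e x" for x by (simp add: circle_char_def cis_cnj)
  \<comment> \<open>The character has period 1, so multiplying by it commutes with periodization;
    the coefficient is then the integral of a periodization and unfolds to the line.\<close>
  have per: "?e (x - of_int n) = ?e x" for x and n :: int
  proof -
    have "- 2 * pi * of_int l * (x - of_int n) = - 2 * pi * of_int l * x + 2 * pi * of_int (l * n)"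
      by (simp add: algebra_simps)
    moreover have "cis (2 * pi * of_int (l * n)) = 1" by (rule cis_multiple_2pi) simp
    ultimately show ?thesis by (metis cis_mult mult.right_neutral)
  qed
  have "periodize g x * ?e x = periodize (\<lambda>y. g y * ?e y) x" for x
    unfolding periodize_def per by (rule infsum_cmult_left'[symmetric])
  then have "fourier_coeff (periodize g) l = (LINT x|lebesgue_on {0..1}. periodize (\<lambda>y. g y * ?e y) x)"
    by (simp add: fourier_coeff_def inner_T_def e_cnj)
  also have "\<dots> = (LINT y|lebesgue. g y * ?e y)"
  proof (rule integral_periodize, rule Bochner_Integration.integrable_bound[OF g])
    have "continuous_on UNIV ?e" by (intro continuous_intros)
    then have [measurable]: "?e \<in> borel_measurable lebesgue"
      using continuous_imp_measurable_on_sets_lebesgue[of UNIV ?e] by (simp add: lebesgue_on_UNIV_eq)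
    have [measurable]: "g \<in> borel_measurable lebesgue" using g by auto
    show "(\<lambda>y. g y * ?e y) \<in> borel_measurable lebesgue" by measurable
  qed (simp add: norm_mult)
  finally show ?thesis by (simp add: fourier_def)
qed

lemma L2_T_imp_L2_unit: "f \<in> L2_T \<Longrightarrow> L2_unit f"
  unfolding L2_T_def square_integrable_def by (auto intro: measurable_restrict_space1)

lemma periodize_in_L2_T:
  assumes g: "integrable lebesgue g"
    and c: "(\<lambda>l. (cmod (fourier g (of_int l)))\<^sup>2) summable_on (UNIV :: int set)"
  shows "periodize g \<in> L2_T"
proof -
  have "L2_unit (periodize g)"
    by (rule square_summable_fourier_coeff_imp_square_integrable[OF integrable_periodize[OF g]])
       (simp add: fourier_coeff_periodize[OF g] c)
  then show ?thesis
    using periodize_measurable[of g] g by (auto simp: L2_T_def square_integrable_def periodize_periodic)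
qed

lemma dyadic_shift_periodize: "dyadic_shift j k (periodize g) = periodize (dyadic_shift j k g)"
proof
  fix x :: real
  have "x - of_int k / 2 ^ j - of_int n = x - of_int n - of_int k / 2 ^ j" for n :: int by simp
  then show "dyadic_shift j k (periodize g) x = periodize (dyadic_shift j k g) x"
    unfolding dyadic_shift_def periodize_def by (simp only:)
qed

lemma integrable_dyadic_shift:
  assumes "integrable lebesgue g"
  shows "integrable lebesgue (dyadic_shift j k g)"
proof -
  have "dyadic_shift j k g = (\<lambda>x. g (- (of_int k / 2 ^ j) + 1 * x))"
    by (simp add: dyadic_shift_def fun_eq_iff)
  then show ?thesis using lebesgue_integrable_real_affine_iff[of 1 g "- (of_int k / 2 ^ j)"] assms by simp
qed

lemma fourier_dyadic_shift:
  "fourier (dyadic_shift j k g) (of_int l) = cis (- 2 * pi * of_int (l * k) / 2 ^ j) * fourier g (of_int l)"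
proof -
  let ?t = "of_int k / 2 ^ j :: real"
  have ph: "cis (- 2 * pi * of_int l * x) = cis (- 2 * pi * of_int (l * k) / 2 ^ j) * cis (- 2 * pi * of_int l * (- ?t + 1 * x))" for x
    by (simp add: cis_mult field_simps)
  have "fourier (dyadic_shift j k g) (of_int l) =
      (LINT x|lebesgue. cis (- 2 * pi * of_int (l * k) / 2 ^ j) * (g (- ?t + 1 * x) * cis (- 2 * pi * of_int l * (- ?t + 1 * x))))"
    unfolding fourier_def dyadic_shift_def
    by (intro Bochner_Integration.integral_cong refl, subst ph) (simp add: mult_ac)
  also have "\<dots> = cis (- 2 * pi * of_int (l * k) / 2 ^ j)
      * (LINT x|lebesgue. g (- ?t + 1 * x) * cis (- 2 * pi * of_int l * (- ?t + 1 * x)))"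
    by (rule integral_mult_right_zero)
  also have "(LINT x|lebesgue. g (- ?t + 1 * x) * cis (- 2 * pi * of_int l * (- ?t + 1 * x))) = fourier g (of_int l)"
    unfolding fourier_def using lebesgue_integral_real_affine[of 1 "\<lambda>x. g x * cis (- 2 * pi * of_int l * x)" "- ?t"] by simp
  finally show ?thesis .
qed

section \<open>Specialization to the extension principle\<close>

lemma filter_cascade_nonstationary_uep:
  assumes "nonstationary_uep \<phi> \<phi>h m0 \<psi> \<psi>h"
  shows "filter_cascade (\<lambda>j l. m0 (Suc j) (of_int l / 2 ^ Suc j)) (\<lambda>j l. \<phi>h j (of_int l))"
proof
  fix j :: nat and l :: int
  have per: "m0 (Suc j) (x + 1) = m0 (Suc j) x" for x
    using assms by (simp add: nonstationary_uep_def L2_T_def)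
  have "of_int (l + 2 ^ Suc j) / 2 ^ Suc j = of_int l / 2 ^ Suc j + (1::real)"
    by (simp add: add_divide_distrib)
  then show "m0 (Suc j) (of_int (l + 2 ^ Suc j) / 2 ^ Suc j) = m0 (Suc j) (of_int l / 2 ^ Suc j)"
    by (simp only: per)
  have "of_int (l + 2 ^ j) / 2 ^ Suc j = of_int l / 2 ^ Suc j + (1 / 2 :: real)"
    by (simp add: add_divide_distrib)
  then show "(cmod (m0 (Suc j) (of_int l / 2 ^ Suc j)))\<^sup>2 + (cmod (m0 (Suc j) (of_int (l + 2 ^ j) / 2 ^ Suc j)))\<^sup>2 = 2"
    using assms by (simp only: nonstationary_uep_def)
  show "\<phi>h j (of_int l) = m0 (Suc j) (of_int l / 2 ^ Suc j) * \<phi>h (Suc j) (of_int l)"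
    using assms unfolding nonstationary_uep_def Suc_eq_plus1 by blast
  show "(\<lambda>j. complex_of_real (2 powr (real j / 2)) * \<phi>h j (of_int l)) \<longlonglongrightarrow> 1"
    using assms unfolding nonstationary_uep_def by blast
qed

theorem proposition1:
  fixes \<phi> \<phi>h m0 \<psi> \<psi>h :: "nat \<Rightarrow> real \<Rightarrow> complex"
  assumes uep: "nonstationary_uep \<phi> \<phi>h m0 \<psi> \<psi>h"
    and \<phi>_L1: "integrable lebesgue (\<phi> 0)"
    and \<psi>_L1: "\<And>j. integrable lebesgue (\<psi> j)"
    and \<phi>h_eq: "\<And>\<xi>. \<phi>h 0 \<xi> = fourier (\<phi> 0) \<xi>"
    and \<psi>h_eq: "\<And>j \<xi>. \<psi>h j \<xi> = fourier (\<psi> j) \<xi>"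
  shows "parseval_frame L2_T inner_T periodic_indices
           (wavelet_system (periodize (\<phi> 0)) (\<lambda>j. periodize (\<psi> j)))"
proof -
  interpret filter_cascade "\<lambda>j l. m0 (Suc j) (of_int l / 2 ^ Suc j)" "\<lambda>j l. \<phi>h j (of_int l)"
    by (rule filter_cascade_nonstationary_uep[OF uep])
  let ?e = "wavelet_system (periodize (\<phi> 0)) (\<lambda>j. periodize (\<psi> j))"
  have "\<forall>j \<xi>. \<psi>h j \<xi> = wavelet_mask (m0 (j + 1)) (\<xi> / 2 ^ (j + 1)) * \<phi>h (j + 1) \<xi>"
    using uep unfolding nonstationary_uep_def by blast
  then have \<psi>h_mask: "\<psi>h j \<xi> = wavelet_mask (m0 (Suc j)) (\<xi> / 2 ^ Suc j) * \<phi>h (Suc j) \<xi>" for j \<xi>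
    unfolding Suc_eq_plus1 by blast
  \<comment> \<open>Here the pointwise representative is identified with the integral of
    \<open>\<psi> j\<close>, so that the abstract array describes the function that is actually
    periodized.\<close>
  have G: "G j l = fourier (\<psi> j) (of_int l)" for j l
  proof -
    have "of_int (l + 2 ^ j) / 2 ^ Suc j = of_int l / 2 ^ Suc j + (1 / 2 :: real)"
      by (simp add: add_divide_distrib)
    then have "G j l = wavelet_mask (m0 (Suc j)) (of_int l / 2 ^ Suc j) * \<phi>h (Suc j) (of_int l)"
      by (simp only: G_def wavelet_mask_def)
    also have "\<dots> = \<psi>h j (of_int l)"
      using \<psi>h_mask by (rule sym)
    finally show ?thesis unfolding \<psi>h_eq .
  qed
  have psi_system: "integrable lebesgue (dyadic_shift j k (\<psi> j)) \<and> ?e (Wavelet j k) = periodize (dyadic_shift j k (\<psi> j))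
      \<and> (\<forall>l. fourier (dyadic_shift j k (\<psi> j)) (of_int l) = system_coeff (Wavelet j k) l)" for j k
    unfolding system_coeff.simps fourier_dyadic_shift wavelet_system.simps dyadic_shift_periodize G
    using integrable_dyadic_shift[OF \<psi>_L1] by blast
  \<comment> \<open>Every frame element is exhibited as the periodization of one integrable
    function: shifting commutes with periodizing. Membership in \<open>L2_T\<close> and the values
    of the coefficients then follow uniformly in the index.\<close>
  have system: "\<exists>u. integrable lebesgue u \<and> ?e i = periodize u \<and> (\<forall>l. fourier u (of_int l) = system_coeff i l)" for i
  proof (cases i)
    case Scaling
    show ?thesis using \<phi>_L1 unfolding Scaling wavelet_system.simps system_coeff.simps \<phi>h_eq by blast
  next
    case (Wavelet j k)
    then show ?thesis using psi_system by blast
  qed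
  have mem: "?e i \<in> L2_T" and coeff: "fourier_coeff (?e i) l = system_coeff i l" for i l
  proof -
    obtain u where u: "integrable lebesgue u" "?e i = periodize u" "\<And>l. fourier u (of_int l) = system_coeff i l"
      using system[of i] by blast
    show "?e i \<in> L2_T"
      unfolding u(2) by (rule periodize_in_L2_T[OF u(1)], unfold u(3), rule system_coeff_summable)
    show "fourier_coeff (?e i) l = system_coeff i l"
      unfolding u(2) fourier_coeff_periodize[OF u(1)] by (rule u(3))
  qed
  have "((\<lambda>i. (cmod (inner_T f (?e i)))\<^sup>2) has_sum Re (inner_T f f)) periodic_indices" if f: "f \<in> L2_T" for f
  proof -
    note fL2 = L2_T_imp_L2_unit[OF f]
    \<comment> \<open>The Parseval identity for a pair requires both functions to be
      square-integrable; for the frame element this is \<open>mem\<close>.\<close>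
    have inner: "inner_T f (?e i) = (\<Sum>\<^sub>\<infinity>l. fourier_coeff f l * cnj (system_coeff i l))" for i
      using infsumI[OF Parseval_fourier_coeff_inner[OF fL2 L2_T_imp_L2_unit[OF mem[of i]]]]
      unfolding coeff by (rule sym)
    have norm: "Re (inner_T f f) = (\<Sum>\<^sub>\<infinity>l. (cmod (fourier_coeff f l))\<^sup>2)"
      unfolding inner_T_self infsumI[OF Parseval_fourier_coeff[OF fL2]] by (rule Re_complex_of_real)
    show ?thesis
      unfolding inner norm
      by (rule cascade_Parseval[OF has_sum_imp_summable[OF Parseval_fourier_coeff[OF fL2]]])
  qed
  with mem show ?thesis unfolding parseval_frame_def by blast
qed

end
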